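(* Suppose $S\subseteq S^2_0=\{\alpha<\omega_2 : \mathrm{cf}(\alpha)=\omega\}$ is stationary (in $\omega_2$). Then $P[S]$ is hemi-proper.
   Context: For $S$ a stationary subset of $S^2_0$, $P[S]$ is the poset of all functions $f$ such that for some $\beta<\omega_1$, $\mathrm{dom}(f)=\beta+1$, $\mathrm{range}(f)\subseteq S$, and $f$ is continuous and increasing; it is ordered by reverse inclusion (extensions are stronger). $H_\lambda$ is the collection of sets hereditarily of cardinality less than $\lambda$; $G_P$ is the canonical name for the generic filter on $P$. A poset $P$ is hemi-proper iff whenever $\lambda$ is a sufficiently large regular cardinal, $M$ and $N$ are countable elementary substructures of $H_\lambda$, $P\in M\in N$, and $q\in P\cap M$, then $q\not\Vdash$ "$\omega_1\cap M[G_P]>\omega_1\cap N$" (that is, $q$ does not force this statement; the two sets are compared as ordinals). *)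

theory Defs
  imports "HOL-Library.Equipollence" "HOL-Library.Countable_Set"
begin

section \<open>A universe of sets\<close>

text \<open>
  HOL has no type of all sets.  For every type \<open>'k\<close> we construct the type \<open>'k hset\<close> of all
  well-founded pure sets that hereditarily have at most \<open>|'k + nat set set set|\<close> elements, as
  well-founded trees modulo bisimilarity.  The theorem is polymorphic in \<open>'k\<close>, and every cardinal
  of a HOL set is a cardinal of \<open>'k hset\<close> for a suitable \<open>'k\<close>.  The summand \<open>nat set set set\<close>
  only guarantees that \<open>\<omega>\<^sub>1\<close>, \<open>\<omega>\<^sub>2\<close> and the posets \<open>P[S]\<close> are elements of every such universe.
\<close>

type_synonym 'k index = "'k + nat set set set"

datatype 'k tree = Node "'k index \<Rightarrow> 'k tree option"

primrec children :: "'k tree \<Rightarrow> 'k tree set" where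
  "children (Node f) = {t. \<exists>i. f i = Some t}"

inductive bisim :: "'k tree \<Rightarrow> 'k tree \<Rightarrow> bool" where
  "(\<forall>x\<in>children a. \<exists>y\<in>children b. bisim x y) \<Longrightarrow>
   (\<forall>y\<in>children b. \<exists>x\<in>children a. bisim x y) \<Longrightarrow> bisim a b"

lemma tree_induct_children:
  assumes "\<And>a. (\<And>x. x \<in> children a \<Longrightarrow> P x) \<Longrightarrow> P a"
  shows "P a"
proof (induction a)
  case (Node f)
  have "P x" if "x \<in> children (Node f)" for x
  proof -
    from that obtain i where "f i = Some x" by auto
    then show ?thesis
      by (intro Node[of "Some x"]) (auto intro: range_eqI[of _ _ i])
  qed
  then show ?case by (rule assms)
qed

lemma bisim_refl: "bisim a a"
  by (induction a rule: tree_induct_children) (auto intro: bisim.intros)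

lemma bisim_sym: "bisim a b \<Longrightarrow> bisim b a"
  by (induction rule: bisim.induct) (rule bisim.intros; blast)

lemma bisim_trans: "bisim a b \<Longrightarrow> bisim b c \<Longrightarrow> bisim a c"
proof (induction a arbitrary: b c rule: tree_induct_children)
  case (1 a)
  have "\<forall>x\<in>children a. \<exists>y\<in>children c. bisim x y"
    by (meson "1" bisim.cases)
  moreover have "\<forall>y\<in>children c. \<exists>x\<in>children a. bisim x y"
    by (meson "1" bisim.cases)
  ultimately show ?case by (rule bisim.intros)
qed

quotient_type 'k hset = "'k tree" / bisim
  by (rule equivpI) (auto simp: reflp_def symp_def transp_def
      intro: bisim_refl bisim_sym elim: bisim_trans)

definition elts :: "'k hset \<Rightarrow> 'k hset set" where
  "elts x = abs_hset ` children (rep_hset x)"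

text \<open>\<open>set_of X\<close> is the set with the elements \<open>X\<close>; it is meaningful for those \<open>X\<close> that are small
  enough to be an element of the universe (see \<open>elts_set_of\<close> below).\<close>

definition set_of :: "'k hset set \<Rightarrow> 'k hset" where
  "set_of X = (THE x. elts x = X)"

lemma abs_hset_eq: "abs_hset a = abs_hset b \<longleftrightarrow> bisim a b"
  using Quotient_rel[OF Quotient_hset] bisim_refl by blast

lemma bisim_rep_abs: "bisim (rep_hset (abs_hset a)) a"
  using Quotient_abs_rep[OF Quotient_hset] abs_hset_eq by blast

lemma elts_abs: "elts (abs_hset a) = abs_hset ` children a"
proof -
  have "bisim (rep_hset (abs_hset a)) a" by (rule bisim_rep_abs)
  then show ?thesis
    unfolding elts_def by cases (fastforce simp: image_iff abs_hset_eq dest: bisim_sym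
      simp flip: abs_hset_eq)
qed

lemma hset_cases: obtains a where "x = abs_hset a"
  using Quotient_abs_rep[OF Quotient_hset] by metis

lemma hset_ext: "elts x = elts y \<longleftrightarrow> x = y"
proof
  assume eq: "elts x = elts y"
  obtain a where a: "x = abs_hset a" by (rule hset_cases)
  obtain b where b: "y = abs_hset b" by (rule hset_cases)
  have *: "abs_hset ` children a = abs_hset ` children b"
    using eq by (simp add: a b elts_abs)
  have "bisim a b"
  proof (rule bisim.intros)
    show "\<forall>x\<in>children a. \<exists>y\<in>children b. bisim x y"
      using equalityD1[OF *] by (auto simp: image_subset_iff image_iff abs_hset_eq)
    show "\<forall>y\<in>children b. \<exists>x\<in>children a. bisim x y"
      using equalityD2[OF *]
      by (auto simp: image_subset_iff image_iff abs_hset_eq intro: bisim_sym)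
  qed
  then show "x = y" by (simp add: a b abs_hset_eq)
qed simp

lemma hset_induct:
  assumes "\<And>x. (\<And>y. y \<in> elts x \<Longrightarrow> P y) \<Longrightarrow> P x"
  shows "P x"
proof -
  have "P (abs_hset a)" for a
    by (induction a rule: tree_induct_children) (rule assms, auto simp: elts_abs)
  then show ?thesis by (metis hset_cases)
qed

lemma wf_elts: "wf {(y, x). y \<in> elts x}"
  unfolding wf_def by (auto intro: hset_induct)

lemma small_iff:
  fixes X :: "'k hset set"
  shows "(\<exists>x. elts x = X) \<longleftrightarrow> X \<lesssim> (UNIV :: 'k index set)"
proof
  assume "\<exists>x. elts x = X"
  then obtain x where x: "elts x = X" by blast
  obtain f where f: "x = abs_hset (Node f)" by (metis hset_cases tree.exhaust)
  have "X \<subseteq> (\<lambda>i. abs_hset (the (f i))) ` UNIV"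
  proof
    fix y assume "y \<in> X"
    then obtain t i where "y = abs_hset t" "f i = Some t"
      using x by (auto simp: f elts_abs)
    then show "y \<in> (\<lambda>i. abs_hset (the (f i))) ` UNIV"
      by (intro image_eqI[of _ _ i]) auto
  qed
  then show "X \<lesssim> (UNIV :: 'k index set)"
    using image_lepoll lepoll_trans subset_imp_lepoll by blast
next
  assume "X \<lesssim> (UNIV :: 'k index set)"
  then obtain g :: "'k hset \<Rightarrow> 'k index" where g: "inj_on g X"
    unfolding lepoll_def by blast
  define a where "a = Node (\<lambda>i. if i \<in> g ` X then Some (rep_hset (inv_into X g i)) else None)"
  have "children a = rep_hset ` X"
    unfolding a_def using g by (auto simp: image_iff) (metis inv_into_f_f)+
  then have "elts (abs_hset a) = X"
    by (simp add: elts_abs image_image Quotient_abs_rep[OF Quotient_hset])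
  then show "\<exists>x. elts x = X" by blast
qed

lemma set_of_elts [simp]: "set_of (elts x) = x"
  unfolding set_of_def by (simp add: hset_ext)

lemma elts_set_of:
  fixes X :: "'k hset set"
  assumes "X \<lesssim> (UNIV :: 'k index set)"
  shows "elts (set_of X) = X"
  using assms small_iff set_of_elts by metis

definition vpair :: "'k hset \<Rightarrow> 'k hset \<Rightarrow> 'k hset" where
  "vpair x y = set_of {set_of {x}, set_of {x, y}}"

lemma infinite_index: "infinite (UNIV :: 'k index set)"
  by (simp add: finite_Plus_UNIV_iff Finite_Set.finite_set)

lemma finite_small: "finite X \<Longrightarrow> X \<lesssim> (UNIV :: 'k index set)"
  using infinite_index finite_lepoll_infinite by blast

lemma vpair_eq_iff [simp]: "vpair a b = vpair c d \<longleftrightarrow> a = c \<and> b = d"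
proof -
  have inj: "set_of X = set_of Y \<longleftrightarrow> X = Y" if "finite X" "finite Y" for X Y :: "'k hset set"
    using that by (metis elts_set_of finite_small)
  show ?thesis
    unfolding vpair_def by (auto simp: inj doubleton_eq_iff)
qed

definition vfun :: "'k hset \<Rightarrow> ('k hset \<Rightarrow> 'k hset) \<Rightarrow> 'k hset" where
  "vfun d F = set_of ((\<lambda>x. vpair x (F x)) ` elts d)"


section \<open>Ordinals, cardinals and stationary sets\<close>

definition transitive :: "'k hset \<Rightarrow> bool" where
  "transitive x \<longleftrightarrow> (\<forall>y\<in>elts x. elts y \<subseteq> elts x)"

definition Ord :: "'k hset \<Rightarrow> bool" where
  "Ord \<alpha> \<longleftrightarrow> transitive \<alpha> \<and> (\<forall>\<beta>\<in>elts \<alpha>. transitive \<beta>)"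

definition Limit :: "'k hset \<Rightarrow> bool" where
  "Limit \<alpha> \<longleftrightarrow> Ord \<alpha> \<and> elts \<alpha> \<noteq> {} \<and> (\<forall>\<xi>\<in>elts \<alpha>. \<exists>\<eta>\<in>elts \<alpha>. \<xi> \<in> elts \<eta>)"

definition vsucc :: "'k hset \<Rightarrow> 'k hset" where
  "vsucc \<alpha> = set_of (insert \<alpha> (elts \<alpha>))"

definition omega :: "'k hset" where
  "omega = set_of {\<alpha>. Ord \<alpha> \<and> finite (elts \<alpha>)}"

definition omega1 :: "'k hset" where
  "omega1 = set_of {\<alpha>. Ord \<alpha> \<and> countable (elts \<alpha>)}"

definition omega2 :: "'k hset" where
  "omega2 = set_of {\<alpha>. Ord \<alpha> \<and> elts \<alpha> \<lesssim> elts (omega1 :: 'k hset)}"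

text \<open>The sets \<open>\<omega>\<close>, \<open>\<omega>\<^sub>1\<close> and \<open>\<omega>\<^sub>2\<close> are elements of every universe.\<close>

lemma lepoll_Ord:
  fixes X :: "'a set"
  shows "{\<alpha> :: 'k hset. Ord \<alpha> \<and> elts \<alpha> \<lesssim> X} \<lesssim> Pow (X \<times> X)"
proof -
  define f where "f = (\<lambda>\<alpha> :: 'k hset. SOME f :: 'k hset \<Rightarrow> 'a. inj_on f (elts \<alpha>) \<and> f ` elts \<alpha> \<subseteq> X)"
  have f: "inj_on (f \<alpha>) (elts \<alpha>) \<and> f \<alpha> ` elts \<alpha> \<subseteq> X" if "elts \<alpha> \<lesssim> X" for \<alpha>
    unfolding f_def
    by (rule someI_ex[of "\<lambda>f. inj_on f (elts \<alpha>) \<and> f ` elts \<alpha> \<subseteq> X"]) (use that in \<open>simp add: lepoll_def\<close>)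
  define r where "r = (\<lambda>\<alpha>. {(f \<alpha> x, f \<alpha> y) | x y. x \<in> elts \<alpha> \<and> y \<in> elts \<alpha> \<and> (x = y \<or> x \<in> elts y)})"
  have irrefl: "x \<notin> elts x" for x :: "'k hset"
    using wf_elts wf_not_refl by fastforce
  have r_iff: "(f \<alpha> x, f \<alpha> y) \<in> r \<alpha> \<longleftrightarrow> x = y \<or> x \<in> elts y"
    if "elts \<alpha> \<lesssim> X" "x \<in> elts \<alpha>" "y \<in> elts \<alpha>" for \<alpha> x y
    using f[OF that(1)] that(2,3) unfolding r_def by (auto dest: inj_onD)
  have r_dom: "fst ` r \<alpha> = f \<alpha> ` elts \<alpha>" for \<alpha>
    unfolding r_def by force
  have "inj_on r {\<alpha>. Ord \<alpha> \<and> elts \<alpha> \<lesssim> X}"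
  proof (rule inj_onI, clarify)
    fix \<alpha> \<beta> assume \<alpha>: "Ord \<alpha>" "elts \<alpha> \<lesssim> X" and \<beta>: "Ord \<beta>" "elts \<beta> \<lesssim> X" and eq: "r \<alpha> = r \<beta>"
    have ran: "f \<alpha> ` elts \<alpha> = f \<beta> ` elts \<beta>" using eq r_dom by metis
    have key: "x \<in> elts \<alpha> \<Longrightarrow> y \<in> elts \<beta> \<Longrightarrow> f \<alpha> x = f \<beta> y \<Longrightarrow> x = y" for x y
    proof (induction x arbitrary: y rule: hset_induct)
      case (1 x)
      have "z \<in> elts y" if z: "z \<in> elts x" for z
      proof -
        have za: "z \<in> elts \<alpha>" using \<alpha>(1) 1 z unfolding Ord_def transitive_def by blast
        then obtain w where w: "w \<in> elts \<beta>" "f \<alpha> z = f \<beta> w" using ran by blast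
        have "z = w" using 1 z za w by blast
        moreover have "(f \<beta> w, f \<beta> y) \<in> r \<beta>" "z \<noteq> x"
          using r_iff[OF \<alpha>(2) za 1(2)] z eq 1 w irrefl by auto
        then have "w = y \<or> w \<in> elts y" "f \<alpha> z \<noteq> f \<alpha> x"
          using r_iff[OF \<beta>(2) w(1) 1(3)] inj_on_eq_iff[OF conjunct1[OF f[OF \<alpha>(2)]] za 1(2)]
          by simp_all
        then have "w \<in> elts y" using w 1(4) by auto
        ultimately show ?thesis by blast
      qed
      moreover have "z \<in> elts x" if z: "z \<in> elts y" for z
      proof -
        have zb: "z \<in> elts \<beta>" using \<beta>(1) 1 z unfolding Ord_def transitive_def by blast
        then obtain w where w: "w \<in> elts \<alpha>" "f \<alpha> w = f \<beta> z" using ran by (metis imageE imageI)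
        have "(f \<alpha> w, f \<alpha> x) \<in> r \<alpha>" "z \<noteq> y"
          using r_iff[OF \<beta>(2) zb 1(3)] z eq 1 w irrefl by auto
        then have "w = x \<or> w \<in> elts x" "f \<beta> z \<noteq> f \<beta> y"
          using r_iff[OF \<alpha>(2) w(1) 1(2)] inj_on_eq_iff[OF conjunct1[OF f[OF \<beta>(2)]] zb 1(3)]
          by simp_all
        then have "w \<in> elts x" using w 1(4) by auto
        then show ?thesis using 1 w zb by blast
      qed
      ultimately show ?case by (metis hset_ext subsetI subset_antisym)
    qed
    have "elts \<alpha> = elts \<beta>"
    proof (intro subset_antisym subsetI)
      fix x assume x: "x \<in> elts \<alpha>"
      then obtain y where "y \<in> elts \<beta>" "f \<alpha> x = f \<beta> y" using ran by blast
      with x show "x \<in> elts \<beta>" using key by blast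
    next
      fix y assume y: "y \<in> elts \<beta>"
      then have "f \<beta> y \<in> f \<alpha> ` elts \<alpha>" using ran by blast
      then obtain x where "x \<in> elts \<alpha>" "f \<alpha> x = f \<beta> y" by force
      with y show "y \<in> elts \<alpha>" using key by blast
    qed
    then show "\<alpha> = \<beta>" by (simp add: hset_ext)
  qed
  moreover have "r ` {\<alpha>. Ord \<alpha> \<and> elts \<alpha> \<lesssim> X} \<subseteq> Pow (X \<times> X)"
    using f unfolding r_def by fast
  ultimately show ?thesis unfolding lepoll_def by blast
qed

lemma lepoll_Pow_mono: "A \<lesssim> B \<Longrightarrow> Pow A \<lesssim> Pow B"
proof -
  assume "A \<lesssim> B"
  then obtain f where f: "inj_on f A" "f ` A \<subseteq> B" unfolding lepoll_def by blast
  then have "inj_on ((`) f) (Pow A)" "(`) f ` Pow A \<subseteq> Pow B"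
    by (auto intro: inj_on_image_Pow)
  then show ?thesis unfolding lepoll_def by blast
qed

lemma infinite_times_lepoll: "infinite A \<Longrightarrow> A \<times> A \<lesssim> A"
  by (rule eqpoll_imp_lepoll)
    (simp add: eqpoll_def card_of_ordIso card_of_Times_same_infinite)

lemma lepoll_Ord_UNIV:
  fixes X :: "'a set"
  assumes "X \<lesssim> (UNIV :: 'b set)" "infinite (UNIV :: 'b set)"
  shows "{\<alpha> :: 'k hset. Ord \<alpha> \<and> elts \<alpha> \<lesssim> X} \<lesssim> (UNIV :: 'b set set)"
proof -
  have "X \<times> X \<lesssim> (UNIV :: 'b set) \<times> (UNIV :: 'b set)"
    using assms(1) by (rule times_lepoll_mono) (rule assms(1))
  also have "(UNIV :: 'b set) \<times> (UNIV :: 'b set) \<lesssim> (UNIV :: 'b set)"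
    by (rule infinite_times_lepoll) fact
  finally have "Pow (X \<times> X) \<lesssim> Pow (UNIV :: 'b set)" by (rule lepoll_Pow_mono)
  with lepoll_Ord show ?thesis unfolding Pow_UNIV by (rule lepoll_trans)
qed

lemma nat_set3_lepoll_index: "(UNIV :: nat set set set set) \<lesssim> (UNIV :: 'k index set)"
  unfolding lepoll_def by (rule exI[of _ Inr]) auto

lemma lepoll_set: "(UNIV :: 'a set) \<lesssim> (UNIV :: 'a set set)"
  using lepoll_Pow_self[of "UNIV :: 'a set"] by simp

lemma countable_Ord_lepoll: "{\<alpha> :: 'k hset. Ord \<alpha> \<and> countable (elts \<alpha>)} \<lesssim> (UNIV :: nat set set)"
  using lepoll_Ord_UNIV[of "UNIV :: nat set", where 'b = nat and 'k = 'k]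
  by (simp add: countable_def lepoll_def)

lemma elts_omega1: "elts omega1 = {\<alpha>. Ord \<alpha> \<and> countable (elts \<alpha>)}"
  unfolding omega1_def
  by (rule elts_set_of)
    (rule lepoll_trans[OF countable_Ord_lepoll lepoll_trans[OF lepoll_set
        lepoll_trans[OF lepoll_set nat_set3_lepoll_index]]])

lemma elts_omega: "elts omega = {\<alpha>. Ord \<alpha> \<and> finite (elts \<alpha>)}"
proof -
  have "{\<alpha> :: 'a hset. Ord \<alpha> \<and> finite (elts \<alpha>)} \<subseteq> elts omega1"
    by (auto simp: elts_omega1 countable_finite)
  then show ?thesis
    unfolding omega_def
    using lepoll_trans[OF subset_imp_lepoll] small_iff by (intro elts_set_of) blast
qed

lemma omega2_lepoll:
  "{\<alpha> :: 'k hset. Ord \<alpha> \<and> elts \<alpha> \<lesssim> elts (omega1 :: 'k hset)} \<lesssim> (UNIV :: nat set set set)"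
  by (rule lepoll_Ord_UNIV) (simp_all add: elts_omega1 countable_Ord_lepoll Finite_Set.finite_set)

lemma elts_omega2: "elts (omega2 :: 'k hset) = {\<alpha>. Ord \<alpha> \<and> elts \<alpha> \<lesssim> elts (omega1 :: 'k hset)}"
  unfolding omega2_def
  by (rule elts_set_of) (rule lepoll_trans[OF omega2_lepoll lepoll_trans[OF lepoll_set nat_set3_lepoll_index]])

definition cofinal_map :: "('k hset \<Rightarrow> 'k hset) \<Rightarrow> 'k hset \<Rightarrow> 'k hset \<Rightarrow> bool" where
  "cofinal_map f \<beta> \<alpha> \<longleftrightarrow> f ` elts \<beta> \<subseteq> elts \<alpha> \<and>
     (\<forall>\<zeta>\<in>elts \<alpha>. \<exists>\<xi>\<in>elts \<beta>. \<zeta> = f \<xi> \<or> \<zeta> \<in> elts (f \<xi>))"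

definition has_cf :: "'k hset \<Rightarrow> 'k hset \<Rightarrow> bool" where
  "has_cf \<alpha> \<beta> \<longleftrightarrow> Ord \<alpha> \<and> Ord \<beta> \<and> (\<exists>f. cofinal_map f \<beta> \<alpha>) \<and>
     (\<forall>\<gamma>\<in>elts \<beta>. \<nexists>f. cofinal_map f \<gamma> \<alpha>)"

definition regular_cardinal :: "'k hset \<Rightarrow> bool" where
  "regular_cardinal \<theta> \<longleftrightarrow> Ord \<theta> \<and> (\<forall>\<alpha>\<in>elts \<theta>. elts \<alpha> \<prec> elts \<theta>) \<and> infinite (elts \<theta>) \<and>
     has_cf \<theta> \<theta>"

definition club :: "'k hset \<Rightarrow> 'k hset set \<Rightarrow> bool" where
  "club \<kappa> C \<longleftrightarrow> C \<subseteq> elts \<kappa> \<and> (\<forall>\<xi>\<in>elts \<kappa>. \<exists>\<eta>\<in>C. \<xi> \<in> elts \<eta>) \<and>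
     (\<forall>\<gamma>\<in>elts \<kappa>. Limit \<gamma> \<and> (\<forall>\<xi>\<in>elts \<gamma>. \<exists>\<eta>\<in>C \<inter> elts \<gamma>. \<xi> \<in> elts \<eta>) \<longrightarrow> \<gamma> \<in> C)"

definition stationary :: "'k hset \<Rightarrow> 'k hset \<Rightarrow> bool" where
  "stationary \<kappa> S \<longleftrightarrow> elts S \<subseteq> elts \<kappa> \<and> (\<forall>C. club \<kappa> C \<longrightarrow> elts S \<inter> C \<noteq> {})"

definition S20 :: "'k hset" where
  "S20 = set_of {\<alpha>\<in>elts omega2. has_cf \<alpha> omega}"


section \<open>Elementary substructures of \<open>H\<^sub>\<lambda>\<close>\<close>

definition trcl :: "'k hset \<Rightarrow> 'k hset set" where
  "trcl x = {y. (y, x) \<in> {(u, v). u \<in> elts v}\<^sup>+}"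

definition H :: "'k hset \<Rightarrow> 'k hset set" where
  "H \<theta> = {x. trcl x \<prec> elts \<theta>}"

text \<open>Formulas of the language of set theory with de Bruijn indices: \<open>Forall\<close> binds index 0.\<close>

datatype fm = Mem nat nat | Eq nat nat | Neg fm | And fm fm | Forall fm

abbreviation Exists :: "fm \<Rightarrow> fm" where "Exists \<phi> \<equiv> Neg (Forall (Neg \<phi>))"
abbreviation Imp :: "fm \<Rightarrow> fm \<Rightarrow> fm" where "Imp \<phi> \<psi> \<equiv> Neg (And \<phi> (Neg \<psi>))"
abbreviation Iff :: "fm \<Rightarrow> fm \<Rightarrow> fm" where "Iff \<phi> \<psi> \<equiv> And (Imp \<phi> \<psi>) (Imp \<psi> \<phi>)"

primrec sat :: "'k hset set \<Rightarrow> (nat \<Rightarrow> 'k hset) \<Rightarrow> fm \<Rightarrow> bool" where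
  "sat A e (Mem i j) \<longleftrightarrow> e i \<in> elts (e j)"
| "sat A e (Eq i j) \<longleftrightarrow> e i = e j"
| "sat A e (Neg \<phi>) \<longleftrightarrow> \<not> sat A e \<phi>"
| "sat A e (And \<phi> \<psi>) \<longleftrightarrow> sat A e \<phi> \<and> sat A e \<psi>"
| "sat A e (Forall \<phi>) \<longleftrightarrow> (\<forall>x\<in>A. sat A (case_nat x e) \<phi>)"

definition elementary :: "'k hset set \<Rightarrow> 'k hset set \<Rightarrow> bool" where
  "elementary M A \<longleftrightarrow> M \<subseteq> A \<and>
     (\<forall>\<phi> e. range e \<subseteq> M \<longrightarrow> (sat M e \<phi> \<longleftrightarrow> sat A e \<phi>))"


section \<open>Forcing\<close>

text \<open>A poset is given by its set \<open>P\<close> of conditions and the set \<open>R\<close> of pairs \<open>(p, q)\<close> with \<open>p \<le> q\<close>,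
  that is, \<open>p\<close> is stronger than \<open>q\<close>.\<close>

definition le :: "'k hset \<Rightarrow> 'k hset \<Rightarrow> 'k hset \<Rightarrow> bool" where
  "le R p q \<longleftrightarrow> vpair p q \<in> elts R"

definition poset :: "'k hset \<Rightarrow> 'k hset \<Rightarrow> bool" where
  "poset P R \<longleftrightarrow> (\<forall>z\<in>elts R. \<exists>p\<in>elts P. \<exists>q\<in>elts P. z = vpair p q) \<and>
     partial_order_on (elts P) {(p, q). le R p q}"

inductive is_name :: "'k hset \<Rightarrow> 'k hset \<Rightarrow> bool" for P where
  "(\<forall>z\<in>elts \<tau>. \<exists>\<sigma> p. z = vpair \<sigma> p \<and> is_name P \<sigma> \<and> p \<in> elts P) \<Longrightarrow> is_name P \<tau>"

text \<open>The forcing relation for atomic formulas.  The usual recursion on names has only positive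
  recursive calls, so that its unique solution is the inductively defined one.\<close>

inductive
  forces_eq :: "'k hset \<Rightarrow> 'k hset \<Rightarrow> 'k hset \<Rightarrow> 'k hset \<Rightarrow> 'k hset \<Rightarrow> bool" and
  forces_mem :: "'k hset \<Rightarrow> 'k hset \<Rightarrow> 'k hset \<Rightarrow> 'k hset \<Rightarrow> 'k hset \<Rightarrow> bool"
  for P R
where
  "(\<forall>\<pi> s. vpair \<pi> s \<in> elts \<sigma> \<longrightarrow> (\<forall>q\<in>elts P. le R q p \<and> le R q s \<longrightarrow> forces_mem P R q \<pi> \<tau>)) \<Longrightarrow>
   (\<forall>\<pi> s. vpair \<pi> s \<in> elts \<tau> \<longrightarrow> (\<forall>q\<in>elts P. le R q p \<and> le R q s \<longrightarrow> forces_mem P R q \<pi> \<sigma>)) \<Longrightarrow>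
   forces_eq P R p \<sigma> \<tau>"
| "(\<forall>q\<in>elts P. le R q p \<longrightarrow> (\<exists>r\<in>elts P. le R r q \<and>
      (\<exists>\<pi> s. vpair \<pi> s \<in> elts \<tau> \<and> le R r s \<and> forces_eq P R r \<sigma> \<pi>))) \<Longrightarrow>
   forces_mem P R p \<sigma> \<tau>"

primrec forces :: "'k hset \<Rightarrow> 'k hset \<Rightarrow> 'k hset \<Rightarrow> (nat \<Rightarrow> 'k hset) \<Rightarrow> fm \<Rightarrow> bool" where
  "forces P R p e (Mem i j) \<longleftrightarrow> forces_mem P R p (e i) (e j)"
| "forces P R p e (Eq i j) \<longleftrightarrow> forces_eq P R p (e i) (e j)"
| "forces P R p e (Neg \<phi>) \<longleftrightarrow> (\<forall>q\<in>elts P. le R q p \<longrightarrow> \<not> forces P R q e \<phi>)"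
| "forces P R p e (And \<phi> \<psi>) \<longleftrightarrow> forces P R p e \<phi> \<and> forces P R p e \<psi>"
| "forces P R p e (Forall \<phi>) \<longleftrightarrow> (\<forall>\<tau>. is_name P \<tau> \<longrightarrow> forces P R p (case_nat \<tau> e) \<phi>)"

text \<open>The canonical name of a ground model set.  Forall conditions are used because posets
  need not have a largest element.\<close>

function check :: "'k hset \<Rightarrow> 'k hset \<Rightarrow> 'k hset" where
  "check P x = set_of (\<Union>y\<in>elts x. (\<lambda>p. vpair (check P y) p) ` elts P)"
  by pat_completeness auto
termination
  by (relation "inv_image {(y, x). y \<in> elts x} snd") (auto intro: wf_elts)

declare check.simps [simp del]

text \<open>The canonical name of \<open>M[G] = {\<tau>[G] | \<tau> \<in> M is a name}\<close>, where \<open>G\<close> is the generic filter.\<close>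

definition ext_name :: "'k hset \<Rightarrow> 'k hset \<Rightarrow> 'k hset" where
  "ext_name P M = set_of {vpair \<tau> p | \<tau> p. \<tau> \<in> elts M \<and> is_name P \<tau> \<and> p \<in> elts P}"

text \<open>The formula \<open>w \<inter> m > w \<inter> n\<close> in the variables \<open>m\<close>, \<open>n\<close>, \<open>w\<close> (indices 0, 1, 2), where \<open>>\<close> is
  the order of the ordinals.\<close>

definition inter_greater :: fm where
  "inter_greater =
     Exists (Exists (And (Forall (Iff (Mem 0 2) (And (Mem 0 5) (Mem 0 3))))
            (And (Forall (Iff (Mem 0 1) (And (Mem 0 5) (Mem 0 4))))
                 (Mem 0 1))))"

lemma sat_inter_greater:
  "sat UNIV (case_nat m (case_nat n (\<lambda>_. w))) inter_greater \<longleftrightarrow>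
     (\<exists>a b. elts a = elts w \<inter> elts m \<and> elts b = elts w \<inter> elts n \<and> b \<in> elts a)"
  unfolding inter_greater_def by (simp add: numeral_eq_Suc set_eq_iff) blast

text \<open>``Sufficiently large'' is the usual \<open>\<lambda> > 2\<^bsup>|P|\<^esup>\<close> (and \<open>P \<in> H\<^sub>\<lambda>\<close>, which follows from \<open>P \<in> M\<close>).
  An unspecified bound, existentially quantified within one universe \<open>'k hset\<close>, could be chosen
  beyond all cardinals of that universe.  The \<open>\<omega>\<^sub>1\<close> of the forced statement is that of the
  ground model.\<close>

definition hemi_proper :: "'k hset \<Rightarrow> 'k hset \<Rightarrow> bool" where
  "hemi_proper P R \<longleftrightarrow> poset P R \<and>
     (\<forall>\<theta> M N q. regular_cardinal \<theta> \<and> Pow (elts P) \<prec> elts \<theta> \<and>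
        countable (elts M) \<and> elementary (elts M) (H \<theta>) \<and>
        countable (elts N) \<and> elementary (elts N) (H \<theta>) \<and>
        vpair P R \<in> elts M \<and> M \<in> elts N \<and> q \<in> elts P \<inter> elts M \<longrightarrow>
        \<not> forces P R q (case_nat (ext_name P M) (case_nat (check P N) (\<lambda>_. check P omega1)))
            inter_greater)"


section \<open>The poset \<open>P[S]\<close>\<close>

definition shoot_conditions :: "'k hset \<Rightarrow> 'k hset set" where
  "shoot_conditions S = {f. \<exists>\<beta> F. \<beta> \<in> elts omega1 \<and> f = vfun (vsucc \<beta>) F \<and>
     F ` elts (vsucc \<beta>) \<subseteq> elts S \<and>
     (\<forall>\<eta>\<in>elts (vsucc \<beta>). \<forall>\<xi>\<in>elts \<eta>. F \<xi> \<in> elts (F \<eta>)) \<and>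
     (\<forall>\<gamma>\<in>elts (vsucc \<beta>). Limit \<gamma> \<longrightarrow> elts (F \<gamma>) = (\<Union>\<xi>\<in>elts \<gamma>. elts (F \<xi>)))}"

definition P_shoot :: "'k hset \<Rightarrow> 'k hset" where
  "P_shoot S = set_of (shoot_conditions S)"

definition reverse_inclusion :: "'k hset \<Rightarrow> 'k hset" where
  "reverse_inclusion P = set_of {vpair p q | p q. p \<in> elts P \<and> q \<in> elts P \<and> elts q \<subseteq> elts p}"

lemma elts_vsucc: "elts (vsucc \<alpha>) = insert \<alpha> (elts \<alpha>)"
proof -
  have "insert \<alpha> (elts \<alpha>) \<lesssim> (UNIV :: 'a index set)"
  proof (cases "finite (elts \<alpha>)")
    case True
    then show ?thesis by (intro finite_small) simp
  next
    case False
    then have "insert \<alpha> (elts \<alpha>) \<lesssim> elts \<alpha>" by (rule infinite_insert_lepoll)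
    moreover have "elts \<alpha> \<lesssim> (UNIV :: 'a index set)" using small_iff by blast
    ultimately show ?thesis by (rule lepoll_trans)
  qed
  then show ?thesis unfolding vsucc_def by (rule elts_set_of)
qed

lemma elts_vfun: "elts (vfun d F) = (\<lambda>x. vpair x (F x)) ` elts d"
proof -
  have "elts d \<lesssim> (UNIV :: 'a index set)" using small_iff by blast
  then show ?thesis unfolding vfun_def by (intro elts_set_of lepoll_trans[OF image_lepoll])
qed

lemma vsucc_omega1: "\<beta> \<in> elts omega1 \<Longrightarrow> elts (vsucc \<beta>) \<subseteq> elts omega1"
proof -
  assume \<beta>: "\<beta> \<in> elts omega1"
  have "\<gamma> \<in> elts omega1" if "\<gamma> \<in> elts \<beta>" for \<gamma>
  proof -
    have "elts \<gamma> \<subseteq> elts \<beta>" "\<forall>\<delta>\<in>elts \<beta>. transitive \<delta>"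
      using \<beta> that by (auto simp: elts_omega1 Ord_def transitive_def)
    then show ?thesis
      using \<beta> that by (auto simp: elts_omega1 Ord_def intro: countable_subset)
  qed
  then show ?thesis using \<beta> by (auto simp: elts_vsucc)
qed

lemma times_small:
  fixes A B :: "'k hset"
  shows "elts A \<times> elts B \<lesssim> (UNIV :: 'k index set)"
proof -
  have "elts A \<times> elts B \<lesssim> (UNIV :: 'k index set) \<times> (UNIV :: 'k index set)"
    by (rule times_lepoll_mono) (use small_iff in blast)+
  also have "(UNIV :: 'k index set) \<times> (UNIV :: 'k index set) \<lesssim> (UNIV :: 'k index set)"
    by (rule infinite_times_lepoll) (rule infinite_index)
  finally show ?thesis .
qed

lemma elts_P_shoot:
  assumes "elts S \<subseteq> elts omega2"
  shows "elts (P_shoot S) = shoot_conditions S"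
  unfolding P_shoot_def
proof (rule elts_set_of)
  let ?I = "UNIV :: nat set set set set"
  let ?Q = "case_prod vpair ` (elts omega1 \<times> elts S)"
  have "elts f \<subseteq> ?Q" if "f \<in> shoot_conditions S" for f
    using that vsucc_omega1 unfolding shoot_conditions_def by (fastforce simp: elts_vfun)
  then have "elts ` shoot_conditions S \<subseteq> Pow ?Q" by blast
  then have 1: "shoot_conditions S \<lesssim> Pow ?Q"
    unfolding lepoll_def by (meson hset_ext inj_onI)
  have "elts (omega1 :: 'a hset) \<lesssim> (UNIV :: nat set set set)"
    unfolding elts_omega1 by (rule lepoll_trans[OF countable_Ord_lepoll lepoll_set])
  moreover have "elts S \<lesssim> (UNIV :: nat set set set)"
    using lepoll_trans[OF subset_imp_lepoll[OF assms[unfolded elts_omega2]] omega2_lepoll] .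
  ultimately have "elts (omega1 :: 'a hset) \<times> elts S \<lesssim> (UNIV :: nat set set set) \<times> (UNIV :: nat set set set)"
    by (rule times_lepoll_mono)
  also have "(UNIV :: nat set set set) \<times> (UNIV :: nat set set set) \<lesssim> (UNIV :: nat set set set)"
    by (rule infinite_times_lepoll) (simp add: Finite_Set.finite_set)
  finally have "?Q \<lesssim> (UNIV :: nat set set set)"
    by (rule lepoll_trans[OF image_lepoll])
  then have "Pow ?Q \<lesssim> ?I" using lepoll_Pow_mono Pow_UNIV by metis
  then show "shoot_conditions S \<lesssim> (UNIV :: 'a index set)"
    using lepoll_trans[OF 1 lepoll_trans[OF _ nat_set3_lepoll_index]] by blast
qed

lemma elts_reverse_inclusion:
  "elts (reverse_inclusion P) = {vpair p q | p q. p \<in> elts P \<and> q \<in> elts P \<and> elts q \<subseteq> elts p}"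
  unfolding reverse_inclusion_def
proof (rule elts_set_of)
  have "{vpair p q | p q. p \<in> elts P \<and> q \<in> elts P \<and> elts q \<subseteq> elts p} \<subseteq>
      case_prod vpair ` (elts P \<times> elts P)" by auto
  then show "{vpair p q | p q. p \<in> elts P \<and> q \<in> elts P \<and> elts q \<subseteq> elts p} \<lesssim> (UNIV :: 'a index set)"
    using lepoll_trans[OF subset_image_lepoll times_small] by blast
qed

end

theory Submission
  imports Defs
begin

text \<open>
  Stationarity of \<open>S\<close> makes \<open>P[S]\<close> distributive: for countably many dense open sets, some \<open>\<alpha> \<in> S\<close> of
  cofinality \<open>\<omega>\<close> is closed enough that a descending sequence meeting all of them has its values
  cofinal in \<open>\<alpha>\<close>, and \<open>\<alpha>\<close> then serves as the last value of a lower bound.  Hence below \<open>q\<close> there is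
  a condition that decides, for each of the countably many names in \<open>M\<close>, which ground model set it
  is, if any.  The forcing relation being definable over \<open>H\<^sub>\<theta>\<close> and \<open>M\<close> being an element and subset of
  \<open>N\<close>, such a condition \<open>p\<close> exists in \<open>N\<close>, and so do the decided values.  Thus \<open>p\<close> forces that the
  ordinals of \<open>M[G]\<close> below \<open>\<omega>\<^sub>1\<close> belong to \<open>N\<close>.
\<close>

section \<open>Definability\<close>

text \<open>A condition generic over M would do as well, but need not exist: it would take the value
  sup (M \<inter> \<open>omega2\<close>) at M \<inter> \<open>omega1\<close>, and this supremum need
  not lie in S. Hence the lower bound is not sought as a limit of conditions in M. Its last value
  comes from stationarity alone and has no tie to M; what matters is only that some such condition
  lies in N. This bounds the countable ordinals named in M by N instead of by M, which is the room
  that the second model provides.\<close>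

text \<open>Formulas are not written out: predicates on environments with values in \<open>A\<close>
  are recognised as definable by the closure rules below. All parameters are entries of the
  environment, so the same formula can be read in a substructure.\<close>

definition definable :: "'k hset set \<Rightarrow> ((nat \<Rightarrow> 'k hset) \<Rightarrow> bool) \<Rightarrow> bool" where
  "definable A Q \<longleftrightarrow> (\<exists>\<phi>. \<forall>e. range e \<subseteq> A \<longrightarrow> (sat A e \<phi> \<longleftrightarrow> Q e))"

lemma definable_mem: "definable A (\<lambda>e. e i \<in> elts (e j))"
  unfolding definable_def by (rule exI[of _ "Mem i j"]) simp

lemma definable_eq: "definable A (\<lambda>e. e i = e j)"
  unfolding definable_def by (rule exI[of _ "Eq i j"]) simp

lemma definable_not: "definable A Q \<Longrightarrow> definable A (\<lambda>e. \<not> Q e)"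
  unfolding definable_def by (metis sat.simps(3))

lemma definable_conj: "definable A Q \<Longrightarrow> definable A Q' \<Longrightarrow> definable A (\<lambda>e. Q e \<and> Q' e)"
  unfolding definable_def by (metis sat.simps(4))

lemma definable_disj: "definable A Q \<Longrightarrow> definable A Q' \<Longrightarrow> definable A (\<lambda>e. Q e \<or> Q' e)"
  using definable_not[OF definable_conj[OF definable_not definable_not], of A Q Q'] by simp

lemma definable_imp: "definable A Q \<Longrightarrow> definable A Q' \<Longrightarrow> definable A (\<lambda>e. Q e \<longrightarrow> Q' e)"
  using definable_disj[OF definable_not, of A Q Q'] by (simp only: imp_conv_disj)

lemma definable_iff: "definable A Q \<Longrightarrow> definable A Q' \<Longrightarrow> definable A (\<lambda>e. Q e \<longleftrightarrow> Q' e)"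
  using definable_conj[OF definable_imp definable_imp, of A Q Q' Q' Q] by (simp only: iff_conv_conj_imp)

text \<open>The environment is shifted under the binder. In this form \<open>intro\<close> can peel
  nested HOL quantifiers by higher-order unification.\<close>

lemma definable_all:
  assumes "definable A (\<lambda>e. Q (e 0) (\<lambda>i. e (Suc i)))"
  shows "definable A (\<lambda>e. \<forall>x\<in>A. Q x e)"
proof -
  obtain \<phi> where \<phi>: "\<And>e. range e \<subseteq> A \<Longrightarrow> sat A e \<phi> \<longleftrightarrow> Q (e 0) (\<lambda>i. e (Suc i))"
    using assms unfolding definable_def by blast
  have "sat A e (Forall \<phi>) \<longleftrightarrow> (\<forall>x\<in>A. Q x e)" if "range e \<subseteq> A" for e
  proof -
    have "sat A (case_nat x e) \<phi> \<longleftrightarrow> Q x e" if "x \<in> A" for x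
    proof -
      have "range (case_nat x e) \<subseteq> A"
        using \<open>range e \<subseteq> A\<close> that by (simp add: image_subset_iff split: nat.splits)
      from \<phi>[OF this] show ?thesis by simp
    qed
    then show ?thesis by simp
  qed
  then show ?thesis unfolding definable_def by blast
qed

lemma definable_ex:
  assumes "definable A (\<lambda>e. Q (e 0) (\<lambda>i. e (Suc i)))"
  shows "definable A (\<lambda>e. \<exists>x\<in>A. Q x e)"
  using definable_not[OF definable_all[of A "\<lambda>x e. \<not> Q x e", OF definable_not[OF assms]]] by simp

lemma definable_cong:
  assumes "definable A Q" "\<And>e. range e \<subseteq> A \<Longrightarrow> Q e \<longleftrightarrow> Q' e"
  shows "definable A Q'"
  using assms unfolding definable_def by meson

lemmas definable_intros =
  definable_mem definable_eq definable_not definable_conj definable_disj definable_imp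
  definable_iff definable_all definable_ex

text \<open>Elementarity acts twice: it pulls the existential statement down to \<open>N\<close>,
  and it lifts the witness chosen there back up, since \<open>Q\<close> refers to truth in
  \<open>A\<close>.\<close>

lemma elementary_witness:
  assumes "elementary N A" "definable A Q" "range e \<subseteq> N" "x \<in> A" "Q (case_nat x e)"
  shows "\<exists>x\<in>N. Q (case_nat x e)"
proof -
  obtain \<phi> where \<phi>: "\<And>e. range e \<subseteq> A \<Longrightarrow> sat A e \<phi> \<longleftrightarrow> Q e"
    using assms(2) unfolding definable_def by blast
  have N: "N \<subseteq> A" "\<And>\<phi> e. range e \<subseteq> N \<Longrightarrow> sat N e \<phi> \<longleftrightarrow> sat A e \<phi>"
    using assms(1) unfolding elementary_def by blast+
  have ran: "range (case_nat y e) \<subseteq> B" if "y \<in> B" "N \<subseteq> B" for y B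
    using assms(3) that by (auto simp: image_subset_iff split: nat.splits)
  have "sat A e (Exists \<phi>)" using \<phi>[OF ran[OF assms(4) N(1)]] assms(4,5) by auto
  then have "sat N e (Exists \<phi>)" using N(2)[OF assms(3)] by blast
  then obtain y where y: "y \<in> N" "sat N (case_nat y e) \<phi>" by auto
  then have "sat A (case_nat y e) \<phi>" using N(2)[OF ran[OF y(1)]] by blast
  then show ?thesis using \<phi>[OF ran] y N(1) by blast
qed

text \<open>A version of \<open>transitive\<close> for HOL sets, because a structure such as
  \<open>H \<theta>\<close> need not be an element of the universe.\<close>

definition tset :: "'k hset set \<Rightarrow> bool" where
  "tset B \<longleftrightarrow> (\<forall>x\<in>B. elts x \<subseteq> B)"

lemma elts_finite: "finite X \<Longrightarrow> elts (set_of X) = X"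
  by (simp add: elts_set_of finite_small)

lemma elts_vpair: "elts (vpair x y) = {set_of {x}, set_of {x, y}}"
  unfolding vpair_def by (simp add: elts_finite)

lemma eq_set_of_iff: "finite X \<Longrightarrow> a = set_of X \<longleftrightarrow> elts a = X"
  by (metis elts_finite set_of_elts)

lemma vpair_in_tset: "tset A \<Longrightarrow> vpair x y \<in> A \<Longrightarrow> x \<in> A \<and> y \<in> A"
  unfolding tset_def by (metis elts_vpair elts_finite finite.emptyI finite.insertI insertCI subsetD)

text \<open>Transitivity of \<open>A\<close> makes the Kuratowski pair absolute: the members of a
  pair in \<open>A\<close>, and their members, lie in \<open>A\<close> again, so quantifiers
  restricted to \<open>A\<close> see all of them.\<close>

lemma definable_pair:
  assumes "tset A"
  shows "definable A (\<lambda>e. e k = vpair (e i) (e j))"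
proof (rule definable_cong)
  show "definable A (\<lambda>e. \<exists>a\<in>A. \<exists>b\<in>A. a \<in> elts (e k) \<and> b \<in> elts (e k) \<and>
     (\<forall>c\<in>A. c \<in> elts (e k) \<longrightarrow> c = a \<or> c = b) \<and> (\<forall>c\<in>A. c \<in> elts a \<longleftrightarrow> c = e i) \<and>
     (\<forall>c\<in>A. c \<in> elts b \<longleftrightarrow> c = e i \<or> c = e j))"
    by (intro definable_intros)
next
  fix e :: "nat \<Rightarrow> 'a hset"
  assume "range e \<subseteq> A"
  then have e: "e i \<in> A" "e j \<in> A" "e k \<in> A" by auto
  have ext: "elts a = X \<longleftrightarrow> (\<forall>c\<in>A. c \<in> elts a \<longleftrightarrow> c \<in> X)" if "a \<in> A" "X \<subseteq> A" for a X
    using that assms unfolding tset_def by blast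
  have "e k = vpair (e i) (e j) \<longleftrightarrow>
     (\<exists>a b. elts (e k) = {a, b} \<and> elts a = {e i} \<and> elts b = {e i, e j})"
    unfolding vpair_def by (simp add: eq_set_of_iff) (metis elts_finite finite.emptyI finite.insertI set_of_elts)
  also have "\<dots> \<longleftrightarrow> (\<exists>a\<in>A. \<exists>b\<in>A. elts (e k) = {a, b} \<and> elts a = {e i} \<and> elts b = {e i, e j})"
    using e(3) assms unfolding tset_def by blast
  also have "\<dots> \<longleftrightarrow> (\<exists>a\<in>A. \<exists>b\<in>A. a \<in> elts (e k) \<and> b \<in> elts (e k) \<and>
     (\<forall>c\<in>A. c \<in> elts (e k) \<longrightarrow> c = a \<or> c = b) \<and> (\<forall>c\<in>A. c \<in> elts a \<longleftrightarrow> c = e i) \<and>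
     (\<forall>c\<in>A. c \<in> elts b \<longleftrightarrow> c = e i \<or> c = e j))"
    by (intro bex_cong refl) (use e in \<open>simp add: ext; blast\<close>)
  finally show "(\<exists>a\<in>A. \<exists>b\<in>A. a \<in> elts (e k) \<and> b \<in> elts (e k) \<and>
     (\<forall>c\<in>A. c \<in> elts (e k) \<longrightarrow> c = a \<or> c = b) \<and> (\<forall>c\<in>A. c \<in> elts a \<longleftrightarrow> c = e i) \<and>
     (\<forall>c\<in>A. c \<in> elts b \<longleftrightarrow> c = e i \<or> c = e j)) \<longleftrightarrow> e k = vpair (e i) (e j)" by simp
qed

lemma definable_pair_mem:
  assumes "tset A"
  shows "definable A (\<lambda>e. vpair (e i) (e j) \<in> elts (e k))"
proof (rule definable_cong)
  show "definable A (\<lambda>e. \<exists>z\<in>A. z = vpair (e i) (e j) \<and> z \<in> elts (e k))"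
    by (intro definable_intros definable_pair assms)
qed (use assms in \<open>auto simp: tset_def\<close>)

lemma definable_triple_mem:
  assumes "tset A"
  shows "definable A (\<lambda>e. vpair (e i) (vpair (e j) (e l)) \<in> elts (e k))"
proof (rule definable_cong)
  show "definable A (\<lambda>e. \<exists>y\<in>A. y = vpair (e j) (e l) \<and> vpair (e i) y \<in> elts (e k))"
    by (intro definable_intros definable_pair definable_pair_mem assms)
next
  fix e :: "nat \<Rightarrow> 'a hset"
  assume "range e \<subseteq> A"
  then show "(\<exists>y\<in>A. y = vpair (e j) (e l) \<and> vpair (e i) y \<in> elts (e k)) \<longleftrightarrow>
     vpair (e i) (vpair (e j) (e l)) \<in> elts (e k)"
    using vpair_in_tset[OF assms, of "e i" "vpair (e j) (e l)"] assms unfolding tset_def by blast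
qed

section \<open>The structure \<open>H\<^sub>\<theta>\<close>\<close>

lemma lesspoll_iff_ordLess: "A \<prec> B \<longleftrightarrow> (card_of A, card_of B) \<in> ordLess"
  using card_of_ordLess[of B A] unfolding lesspoll_def lepoll_def eqpoll_def
  card_of_ordIso card_of_ordLeq by (metis not_ordLess_ordIso ordLeq_iff_ordLess_or_ordIso)

lemma lesspoll_Un:
  assumes "A \<prec> C" "B \<prec> C" "infinite C"
  shows "A \<union> B \<prec> C"
  using card_of_Un_ordLess_infinite[OF assms(3)] assms(1,2) by (simp add: lesspoll_iff_ordLess)

lemma lesspoll_Times:
  assumes "A \<prec> C" "infinite C"
  shows "A \<times> A \<prec> C"
proof (cases "finite A")
  case True
  then show ?thesis using assms(2) by (simp add: finite_lesspoll_infinite)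
next
  case False
  then show ?thesis by (rule lesspoll_trans1[OF infinite_times_lepoll assms(1)])
qed

lemma trcl_least: "tset B \<Longrightarrow> elts x \<subseteq> B \<Longrightarrow> trcl x \<subseteq> B"
proof
  fix y assume "tset B" "elts x \<subseteq> B" "y \<in> trcl x"
  from this(3) have "(y, x) \<in> {(u, v). u \<in> elts v}\<^sup>+" unfolding trcl_def by simp
  then show "y \<in> B"
    by (induction rule: converse_trancl_induct) (use \<open>tset B\<close> \<open>elts x \<subseteq> B\<close> in \<open>auto simp: tset_def\<close>)
qed

lemma tset_insert_trcl: "tset (insert x (trcl x))"
  unfolding tset_def trcl_def by (auto intro: trancl_into_trancl2)

text \<open>Any small transitive set containing \<open>x\<close> bounds its transitive closure, so
  closures of constructed sets never have to be computed. Infinity of \<open>\<theta>\<close> pays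
  for adding \<open>x\<close> itself to \<open>trcl x\<close>.\<close>

lemma H_iff:
  assumes "infinite (elts \<theta>)"
  shows "x \<in> H \<theta> \<longleftrightarrow> (\<exists>B. tset B \<and> x \<in> B \<and> B \<prec> elts \<theta>)"
proof
  assume "x \<in> H \<theta>"
  then have "{x} \<union> trcl x \<prec> elts \<theta>"
    using assms
    by (intro lesspoll_Un) (simp_all add: H_def finite_lesspoll_infinite)
  then show "\<exists>B. tset B \<and> x \<in> B \<and> B \<prec> elts \<theta>"
    using tset_insert_trcl[of x] by auto
next
  assume "\<exists>B. tset B \<and> x \<in> B \<and> B \<prec> elts \<theta>"
  then obtain B where B: "tset B" "x \<in> B" "B \<prec> elts \<theta>" by blast
  have "trcl x \<prec> elts \<theta>"
    by (rule lesspoll_trans1[OF subset_imp_lepoll[OF trcl_least[OF B(1)]] B(3)])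
      (use B in \<open>auto simp: tset_def\<close>)
  then show "x \<in> H \<theta>" by (simp add: H_def)
qed

lemma tset_H: "tset (H \<theta>)"
proof -
  have "trcl y \<subseteq> trcl x" if "y \<in> elts x" for x y :: "'a hset"
    using that unfolding trcl_def by (auto intro: trancl_into_trancl)
  then show ?thesis
    unfolding tset_def H_def using lesspoll_trans1[OF subset_imp_lepoll] by blast
qed

text \<open>This places the relations and enumerations constructed below in
  \<open>H \<theta>\<close>. The bound on \<open>B\<close> also makes \<open>set_of X\<close>
  meaningful.\<close>

lemma set_of_in_H:
  assumes "tset B" "B \<prec> elts \<theta>" "X \<subseteq> B"
  shows "set_of X \<in> H \<theta>" and "elts (set_of X) = X"
proof -
  have "X \<lesssim> elts \<theta>"
    by (rule lepoll_trans[OF subset_imp_lepoll[OF assms(3)] lesspoll_imp_lepoll[OF assms(2)]])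
  then show eq: "elts (set_of X) = X"
    using small_iff lepoll_trans by (metis elts_set_of)
  show "set_of X \<in> H \<theta>"
    unfolding H_def mem_Collect_eq
    by (rule lesspoll_trans1[OF subset_imp_lepoll[OF trcl_least[OF assms(1)]] assms(2)])
      (simp add: eq assms(3))
qed

text \<open>One round adds the unordered pairs over \<open>B\<close>, two rounds the ordered ones.
  Adding ordered pairs directly would destroy transitivity.\<close>

definition pairing_closure :: "'k hset set \<Rightarrow> 'k hset set" where
  "pairing_closure B = B \<union> (\<lambda>(x, y). set_of {x, y}) ` (B \<times> B)"

lemma tset_pairing_closure: "tset B \<Longrightarrow> tset (pairing_closure B)"
  unfolding tset_def pairing_closure_def by (auto simp: elts_finite)

lemma pairing_closure_lesspoll:
  "B \<prec> U \<Longrightarrow> infinite U \<Longrightarrow> pairing_closure B \<prec> U"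
  unfolding pairing_closure_def
  by (intro lesspoll_Un lesspoll_trans1[OF image_lepoll] lesspoll_Times)

lemma pair_in_pairing_closure:
  "x \<in> B \<Longrightarrow> y \<in> B \<Longrightarrow> set_of {x, y} \<in> pairing_closure B"
  unfolding pairing_closure_def by auto

lemma vpair_in_pairing_closure:
  assumes "x \<in> B" "y \<in> B"
  shows "vpair x y \<in> pairing_closure (pairing_closure B)"
  unfolding vpair_def
  using pair_in_pairing_closure[OF assms(1,1)] pair_in_pairing_closure[OF assms]
  by (intro pair_in_pairing_closure[of _ "pairing_closure B"]) simp_all

section \<open>Deciding the value of a name\<close>

text \<open>\<open>p\<close> forces that \<open>\<tau>\<close> is the ground model set \<open>x\<close>.  The recursion speaks about \<open>x\<close> itself, so no
  check names have to be defined in \<open>H\<^sub>\<theta>\<close>.\<close>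

inductive forces_val :: "'k hset \<Rightarrow> 'k hset \<Rightarrow> 'k hset \<Rightarrow> 'k hset \<Rightarrow> 'k hset \<Rightarrow> bool" for P R where
  "(\<forall>\<pi> s. vpair \<pi> s \<in> elts \<tau> \<longrightarrow> (\<forall>q\<in>elts P. le R q p \<and> le R q s \<longrightarrow>
      (\<exists>r\<in>elts P. le R r q \<and> (\<exists>y\<in>elts x. forces_val P R r \<pi> y)))) \<Longrightarrow>
   (\<forall>y\<in>elts x. \<forall>q\<in>elts P. le R q p \<longrightarrow>
      (\<exists>r\<in>elts P. le R r q \<and> (\<exists>\<pi> s. vpair \<pi> s \<in> elts \<tau> \<and> le R r s \<and> forces_val P R r \<pi> y))) \<Longrightarrow>
   forces_val P R p \<tau> x"

lemma forces_valD1: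
  assumes "forces_val P R p \<tau> x" "vpair \<pi> s \<in> elts \<tau>" "q \<in> elts P" "le R q p" "le R q s"
  obtains r y where "r \<in> elts P" "le R r q" "y \<in> elts x" "forces_val P R r \<pi> y"
proof -
  from assms(1) have "\<exists>r\<in>elts P. le R r q \<and> (\<exists>y\<in>elts x. forces_val P R r \<pi> y)"
  proof cases
    case 1
    from 1(1)[rule_format, OF assms(2,3)] assms(4,5) show ?thesis by blast
  qed
  then show ?thesis using that by blast
qed

lemma forces_valD2:
  assumes "forces_val P R p \<tau> x" "y \<in> elts x" "q \<in> elts P" "le R q p"
  obtains r \<pi> s where "r \<in> elts P" "le R r q" "vpair \<pi> s \<in> elts \<tau>" "le R r s" "forces_val P R r \<pi> y"
proof -
  from assms(1) have "\<exists>r\<in>elts P. le R r q \<and> (\<exists>\<pi> s. vpair \<pi> s \<in> elts \<tau> \<and> le R r s \<and> forces_val P R r \<pi> y)"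
  proof cases
    case 1
    from 1(2)[rule_format, OF assms(2,3,4)] show ?thesis .
  qed
  then show ?thesis using that by blast
qed

lemma forces_memD:
  assumes "forces_mem P R p \<sigma> \<tau>" "q \<in> elts P" "le R q p"
  obtains r \<pi> s where "r \<in> elts P" "le R r q" "vpair \<pi> s \<in> elts \<tau>" "le R r s" "forces_eq P R r \<sigma> \<pi>"
proof -
  from assms(1) have "\<exists>r\<in>elts P. le R r q \<and> (\<exists>\<pi> s. vpair \<pi> s \<in> elts \<tau> \<and> le R r s \<and> forces_eq P R r \<sigma> \<pi>)"
  proof cases
    case 1
    from 1[rule_format, OF assms(2,3)] show ?thesis .
  qed
  then show ?thesis using that by blast
qed

lemma forces_eqD:
  assumes "forces_eq P R p \<sigma> \<tau>" "vpair \<pi> s \<in> elts \<sigma>" "q \<in> elts P" "le R q p" "le R q s"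
  shows "forces_mem P R q \<pi> \<tau>"
  using assms(1)
proof cases
  case 1
  from 1(1)[rule_format, OF assms(2,3)] assms(4,5) show ?thesis by blast
qed

lemma forces_eq_sym: "forces_eq P R p \<sigma> \<tau> \<Longrightarrow> forces_eq P R p \<tau> \<sigma>"
  by (erule forces_eq.cases) (simp add: forces_eq_forces_mem.intros(1))

section \<open>Check names and the name of M[G]\<close>

lemma elts_check: "elts (check P x) = (\<Union>y\<in>elts x. (\<lambda>p. vpair (check P y) p) ` elts P)"
proof -
  have "(\<Union>y\<in>elts x. (\<lambda>p. vpair (check P y) p) ` elts P) =
      (\<lambda>(y, p). vpair (check P y) p) ` (elts x \<times> elts P)" by auto
  also have "\<dots> \<lesssim> (UNIV :: 'a index set)"
    by (rule lepoll_trans[OF image_lepoll times_small])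
  finally show ?thesis by (subst check.simps) (rule elts_set_of)
qed

lemma is_name_check: "is_name P (check P x)"
proof (induction x rule: hset_induct)
  case (1 x)
  then show ?case by (intro is_name.intros) (auto simp: elts_check)
qed

lemma elts_ext_name:
  "elts (ext_name P M) = {vpair \<tau> p | \<tau> p. \<tau> \<in> elts M \<and> is_name P \<tau> \<and> p \<in> elts P}"
  unfolding ext_name_def
proof (rule elts_set_of)
  have "{vpair \<tau> p | \<tau> p. \<tau> \<in> elts M \<and> is_name P \<tau> \<and> p \<in> elts P} \<subseteq>
      case_prod vpair ` (elts M \<times> elts P)" by auto
  then show "{vpair \<tau> p | \<tau> p. \<tau> \<in> elts M \<and> is_name P \<tau> \<and> p \<in> elts P} \<lesssim> (UNIV :: 'a index set)"
    using lepoll_trans[OF subset_image_lepoll times_small] by blast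
qed

section \<open>Values of names over a fixed poset\<close>

locale forcing_poset =
  fixes P R :: "'k hset"
  assumes poset: "poset P R"
begin

lemma le_refl: "p \<in> elts P \<Longrightarrow> le R p p"
  using poset unfolding poset_def partial_order_on_def preorder_on_def refl_on_def by blast

lemma le_trans: "le R p q \<Longrightarrow> le R q r \<Longrightarrow> le R p r"
  using poset unfolding poset_def partial_order_on_def preorder_on_def trans_def by blast

lemma le_in: "le R p q \<Longrightarrow> p \<in> elts P \<and> q \<in> elts P"
  using poset unfolding poset_def partial_order_on_def preorder_on_def by blast

lemma forces_val_mono:
  assumes "forces_val P R p \<tau> x" "le R q p"
  shows "forces_val P R q \<tau> x"
  using assms(1)
proof cases
  case 1
  show ?thesis
    by (rule forces_val.intros; intro allI ballI impI)
      (use 1(1) le_trans[OF _ assms(2)] in metis, use 1(2) le_trans[OF _ assms(2)] in metis)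
qed

lemma forces_eq_mono:
  assumes "forces_eq P R p \<sigma> \<tau>" "le R q p"
  shows "forces_eq P R q \<sigma> \<tau>"
  using assms(1)
proof cases
  case 1
  show ?thesis
    by (rule forces_eq_forces_mem.intros(1); intro allI ballI impI)
      (use 1(1) le_trans[OF _ assms(2)] in metis, use 1(2) le_trans[OF _ assms(2)] in metis)
qed

text \<open>An element of \<open>x\<close> is the value, at a stronger condition, of a name in
  \<open>\<tau>\<close>; strengthening once more gives that name a value in \<open>x'\<close> too.
  Hence the induction runs over all conditions and names at once.\<close>

lemma forces_val_unique:
  assumes "p \<in> elts P" "forces_val P R p \<tau> x" "forces_val P R p \<tau> x'"
  shows "x = x'"
  using assms
proof (induction x arbitrary: p \<tau> x' rule: hset_induct)
  case (1 x)
  have "y \<in> elts x'" if y: "y \<in> elts x" for y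
  proof -
    obtain r \<pi> s where r: "r \<in> elts P" "le R r p" "vpair \<pi> s \<in> elts \<tau>" "le R r s" "forces_val P R r \<pi> y"
      by (rule forces_valD2[OF 1(3) y 1(2) le_refl[OF 1(2)]])
    obtain r' y' where r': "r' \<in> elts P" "le R r' r" "y' \<in> elts x'" "forces_val P R r' \<pi> y'"
      by (rule forces_valD1[OF 1(4) r(3,1,2,4)])
    show ?thesis using 1(1)[OF y r'(1) forces_val_mono[OF r(5) r'(2)] r'(4)] r'(3) by simp
  qed
  moreover have "y \<in> elts x" if y: "y \<in> elts x'" for y
  proof -
    obtain r \<pi> s where r: "r \<in> elts P" "le R r p" "vpair \<pi> s \<in> elts \<tau>" "le R r s" "forces_val P R r \<pi> y"
      by (rule forces_valD2[OF 1(4) y 1(2) le_refl[OF 1(2)]])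
    obtain r' y' where r': "r' \<in> elts P" "le R r' r" "y' \<in> elts x" "forces_val P R r' \<pi> y'"
      by (rule forces_valD1[OF 1(3) r(3,1,2,4)])
    show ?thesis using 1(1)[OF r'(3,1,4) forces_val_mono[OF r(5) r'(2)]] r'(3) by simp
  qed
  ultimately show ?case by (metis hset_ext subsetI subset_antisym)
qed

text \<open>A name for a member of M[G] is merely forced to equal some name in M. This carries its
  value over to the latter.\<close>

lemma forces_val_cong:
  assumes "forces_eq P R p \<pi> \<tau>" "forces_val P R p \<pi> x"
  shows "forces_val P R p \<tau> x"
  using assms
proof (induction x arbitrary: p \<pi> \<tau> rule: hset_induct)
  case (1 x)
  show ?case
  proof (rule forces_val.intros; intro allI ballI impI)
    fix \<rho> s q assume \<rho>: "vpair \<rho> s \<in> elts \<tau>" "q \<in> elts P" "le R q p \<and> le R q s"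
    then have "forces_mem P R q \<rho> \<pi>" using forces_eqD[OF forces_eq_sym[OF 1(2)]] by blast
    then obtain r1 \<sigma> t where r1: "r1 \<in> elts P" "le R r1 q" "vpair \<sigma> t \<in> elts \<pi>" "le R r1 t" "forces_eq P R r1 \<rho> \<sigma>"
      using forces_memD \<rho>(2) le_refl by metis
    obtain r2 y where r2: "r2 \<in> elts P" "le R r2 r1" "y \<in> elts x" "forces_val P R r2 \<sigma> y"
      by (rule forces_valD1[OF 1(3) r1(3,1) _ r1(4)]) (use le_trans r1(2) \<rho>(3) in blast)
    have "forces_val P R r2 \<rho> y"
      by (rule 1(1)[OF r2(3) forces_eq_sym[OF forces_eq_mono[OF r1(5) r2(2)]] r2(4)])
    then show "\<exists>r\<in>elts P. le R r q \<and> (\<exists>y\<in>elts x. forces_val P R r \<rho> y)"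
      using r2 r1 le_trans by blast
  next
    fix y q assume y: "y \<in> elts x" "q \<in> elts P" "le R q p"
    obtain r1 \<sigma> t where r1: "r1 \<in> elts P" "le R r1 q" "vpair \<sigma> t \<in> elts \<pi>" "le R r1 t" "forces_val P R r1 \<sigma> y"
      by (rule forces_valD2[OF 1(3) y])
    have "forces_mem P R r1 \<sigma> \<tau>"
      using forces_eqD[OF 1(2) r1(3,1)] r1 y(3) le_trans by blast
    then obtain r2 \<rho> s where r2: "r2 \<in> elts P" "le R r2 r1" "vpair \<rho> s \<in> elts \<tau>" "le R r2 s" "forces_eq P R r2 \<sigma> \<rho>"
      using forces_memD r1(1) le_refl by metis
    have "forces_val P R r2 \<rho> y"
      by (rule 1(1)[OF y(1) r2(5) forces_val_mono[OF r1(5) r2(2)]])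
    then show "\<exists>r\<in>elts P. le R r q \<and> (\<exists>\<pi> s. vpair \<pi> s \<in> elts \<tau> \<and> le R r s \<and> forces_val P R r \<pi> y)"
      using r1 r2 le_trans by blast
  qed
qed

text \<open>The bridge from the check names of the forced statement to values: members of a check
  name are check names again, so the induction on \<open>x\<close> can follow them.\<close>

lemma forces_val_if_forces_eq_check:
  assumes "forces_eq P R p \<tau> (check P x)"
  shows "forces_val P R p \<tau> x"
  using assms
proof (induction x arbitrary: p \<tau> rule: hset_induct)
  case (1 x)
  show ?case
  proof (rule forces_val.intros; intro allI ballI impI)
    fix \<rho> s q assume \<rho>: "vpair \<rho> s \<in> elts \<tau>" "q \<in> elts P" "le R q p \<and> le R q s"
    then have "forces_mem P R q \<rho> (check P x)" using forces_eqD[OF 1(2)] by blast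
    then obtain r \<sigma> t where r: "r \<in> elts P" "le R r q" "vpair \<sigma> t \<in> elts (check P x)" "forces_eq P R r \<rho> \<sigma>"
      using forces_memD \<rho>(2) le_refl by metis
    then obtain y where "y \<in> elts x" "\<sigma> = check P y" by (auto simp: elts_check)
    then show "\<exists>r\<in>elts P. le R r q \<and> (\<exists>y\<in>elts x. forces_val P R r \<rho> y)"
      using r 1(1) by blast
  next
    fix y q assume y: "y \<in> elts x" "q \<in> elts P" "le R q p"
    then have "vpair (check P y) q \<in> elts (check P x)" by (auto simp: elts_check)
    then have "forces_mem P R q (check P y) \<tau>"
      using forces_eqD[OF forces_eq_sym[OF 1(2)]] y le_refl by blast
    then obtain r \<rho> s where r: "r \<in> elts P" "le R r q" "vpair \<rho> s \<in> elts \<tau>" "le R r s" "forces_eq P R r (check P y) \<rho>"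
      using forces_memD y(2) le_refl by metis
    then show "\<exists>r\<in>elts P. le R r q \<and> (\<exists>\<pi> s. vpair \<pi> s \<in> elts \<tau> \<and> le R r s \<and> forces_val P R r \<pi> y)"
      using 1(1)[OF y(1) forces_eq_sym] by blast
  qed
qed

lemma forces_eq_check_refl: "forces_eq P R p (check P x) (check P x)"
proof (induction x arbitrary: p rule: hset_induct)
  case (1 x)
  have "forces_mem P R q \<pi> (check P x)"
    if \<pi>: "vpair \<pi> s \<in> elts (check P x)" for \<pi> s q
  proof (rule forces_eq_forces_mem.intros(2), intro ballI impI)
    fix r assume r: "r \<in> elts P" "le R r q"
    obtain y where y: "y \<in> elts x" "\<pi> = check P y" using \<pi> by (auto simp: elts_check)
    \<comment> \<open>A check name pairs its elements with every condition, so \<open>r\<close>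
      itself can be the second coordinate.\<close>
    then have "vpair \<pi> r \<in> elts (check P x)" using r by (auto simp: elts_check)
    moreover have "forces_eq P R r \<pi> \<pi>" using y 1 by blast
    ultimately show "\<exists>r'\<in>elts P. le R r' r \<and>
      (\<exists>\<pi>' s. vpair \<pi>' s \<in> elts (check P x) \<and> le R r' s \<and> forces_eq P R r' \<pi> \<pi>')"
      using r(1) le_refl by blast
  qed
  then show ?case by (intro forces_eq_forces_mem.intros(1)) blast+
qed

lemma forces_mem_check:
  assumes "x \<in> elts X"
  shows "forces_mem P R p (check P x) (check P X)"
proof (rule forces_eq_forces_mem.intros(2), intro ballI impI)
  fix q assume q: "q \<in> elts P"
  then have "vpair (check P x) q \<in> elts (check P X)" using assms by (auto simp: elts_check)
  then show "\<exists>r\<in>elts P. le R r q \<and>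
      (\<exists>\<pi> s. vpair \<pi> s \<in> elts (check P X) \<and> le R r s \<and> forces_eq P R r (check P x) \<pi>)"
    using q le_refl forces_eq_check_refl by blast
qed

end

text \<open>The recursion of \<open>forces_val\<close> is positive and well-founded, so \<open>forces_val P R p \<tau> x\<close> holds iff
  \<open>(p, \<tau>, x)\<close> lies in some set \<open>W\<close> of triples each of which is justified by other triples in \<open>W\<close>;
  this makes it definable over \<open>H\<^sub>\<theta>\<close>.\<close>

definition val_witness :: "'k hset set \<Rightarrow> 'k hset \<Rightarrow> 'k hset \<Rightarrow> 'k hset \<Rightarrow> bool" where
  "val_witness A P R W \<longleftrightarrow> (\<forall>p\<in>A. \<forall>\<tau>\<in>A. \<forall>x\<in>A. vpair p (vpair \<tau> x) \<in> elts W \<longrightarrow>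
     (\<forall>\<pi>\<in>A. \<forall>s\<in>A. vpair \<pi> s \<in> elts \<tau> \<longrightarrow> (\<forall>q\<in>A. q \<in> elts P \<longrightarrow>
        vpair q p \<in> elts R \<and> vpair q s \<in> elts R \<longrightarrow>
        (\<exists>r\<in>A. r \<in> elts P \<and> vpair r q \<in> elts R \<and>
           (\<exists>y\<in>A. y \<in> elts x \<and> vpair r (vpair \<pi> y) \<in> elts W)))) \<and>
     (\<forall>y\<in>A. y \<in> elts x \<longrightarrow> (\<forall>q\<in>A. q \<in> elts P \<longrightarrow> vpair q p \<in> elts R \<longrightarrow>
        (\<exists>r\<in>A. r \<in> elts P \<and> vpair r q \<in> elts R \<and>
           (\<exists>\<pi>\<in>A. \<exists>s\<in>A. vpair \<pi> s \<in> elts \<tau> \<and> vpair r s \<in> elts R \<and>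
              vpair r (vpair \<pi> y) \<in> elts W)))))"

text \<open>By induction on \<open>x\<close> the witness unfolds into the clauses of
  \<open>forces_val\<close>; transitivity of \<open>A\<close> ensures that the bounded quantifiers
  of \<open>val_witness\<close> miss nothing.\<close>

lemma forces_val_if_witness:
  assumes A: "tset A" "P \<in> A" and W: "W \<in> A" "val_witness A P R W"
  assumes "vpair p (vpair \<tau> x) \<in> elts W"
  shows "forces_val P R p \<tau> x"
  using assms(5)
proof (induction x arbitrary: p \<tau> rule: hset_induct)
  case (1 x)
  have AE: "y \<in> A" if "y \<in> elts x" "x \<in> A" for x y
    using A(1) that unfolding tset_def by blast
  have "vpair p (vpair \<tau> x) \<in> A" using AE 1(2) W(1) by blast
  then have in_A: "p \<in> A" "\<tau> \<in> A" "x \<in> A" using vpair_in_tset[OF A(1)] by blast+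
  note w = W(2)[unfolded val_witness_def, rule_format, OF in_A 1(2)]
  show ?case
  proof (rule forces_val.intros; intro allI ballI impI)
    fix \<pi> s q assume *: "vpair \<pi> s \<in> elts \<tau>" "q \<in> elts P" "le R q p \<and> le R q s"
    have "\<pi> \<in> A" "s \<in> A" using *(1) in_A(2) AE vpair_in_tset[OF A(1)] by blast+
    moreover have "q \<in> A" using *(2) A(2) AE by blast
    ultimately obtain r y where "r \<in> elts P" "vpair r q \<in> elts R" "y \<in> elts x"
        "vpair r (vpair \<pi> y) \<in> elts W"
      using conjunct1[OF w, rule_format, of \<pi> s q] * unfolding le_def by blast
    then show "\<exists>r\<in>elts P. le R r q \<and> (\<exists>y\<in>elts x. forces_val P R r \<pi> y)"
      unfolding le_def using 1(1) by blast
  next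
    fix y q assume *: "y \<in> elts x" "q \<in> elts P" "le R q p"
    have "y \<in> A" using *(1) in_A(3) AE by blast
    moreover have "q \<in> A" using *(2) A(2) AE by blast
    ultimately obtain r \<pi> s where "r \<in> elts P" "vpair r q \<in> elts R" "vpair \<pi> s \<in> elts \<tau>"
        "vpair r s \<in> elts R" "vpair r (vpair \<pi> y) \<in> elts W"
      using conjunct2[OF w, rule_format, of y q] * unfolding le_def by blast
    then show "\<exists>r\<in>elts P. le R r q \<and> (\<exists>\<pi> s. vpair \<pi> s \<in> elts \<tau> \<and> le R r s \<and> forces_val P R r \<pi> y)"
      unfolding le_def using 1(1)[OF *(1)] by blast
  qed
qed

text \<open>The recursion visits only elements of \<open>P\<close>, sets below \<open>x\<close> and
  names inside \<open>\<tau>\<close>, hence stays in a small transitive set \<open>C\<close>. The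
  restriction of \<open>forces_val\<close> to \<open>C\<close> justifies itself.\<close>

lemma forces_val_witness_exists:
  assumes inf: "infinite (elts \<theta>)"
    and mem: "P \<in> H \<theta>" "p \<in> H \<theta>" "\<tau> \<in> H \<theta>" "x \<in> H \<theta>"
    and val: "forces_val P R p \<tau> x"
  shows "\<exists>W\<in>H \<theta>. vpair p (vpair \<tau> x) \<in> elts W \<and> val_witness (H \<theta>) P R W"
proof -
  have "\<exists>B. tset B \<and> z \<in> B \<and> B \<prec> elts \<theta>" if "z \<in> H \<theta>" for z
    using that H_iff[OF inf] by blast
  then obtain B where B: "\<And>z. z \<in> H \<theta> \<Longrightarrow> tset (B z) \<and> z \<in> B z \<and> B z \<prec> elts \<theta>" by metis
  define C where "C = B P \<union> B p \<union> B \<tau> \<union> B x"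
  have C: "tset C" "C \<prec> elts \<theta>" "P \<in> C" "p \<in> C" "\<tau> \<in> C" "x \<in> C"
  proof -
    show "tset C" using B mem unfolding C_def tset_def by blast
    show "C \<prec> elts \<theta>" unfolding C_def using B mem inf by (intro lesspoll_Un) auto
  qed (use B mem in \<open>auto simp: C_def\<close>)
  have CE: "y \<in> C" if "y \<in> elts z" "z \<in> C" for y z
    using C(1) that unfolding tset_def by blast
  have CH: "z \<in> H \<theta>" if "z \<in> C" for z
    using H_iff[OF inf] C(1,2) that by blast
  let ?U = "\<lambda>B. pairing_closure (pairing_closure B)"
  define X where "X = {vpair p (vpair \<tau> x) | p \<tau> x. p \<in> C \<and> \<tau> \<in> C \<and> x \<in> C \<and> forces_val P R p \<tau> x}"
  \<comment> \<open>A triple is a pair whose second coordinate is a pair, hence two applications of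
    \<open>?U\<close>.\<close>
  have "X \<subseteq> ?U (?U C)"
  proof -
    have "C \<subseteq> ?U C" unfolding pairing_closure_def by blast
    then show ?thesis
      unfolding X_def using vpair_in_pairing_closure[of _ C] vpair_in_pairing_closure[of _ "?U C"] by blast
  qed
  then have W: "set_of X \<in> H \<theta>" "elts (set_of X) = X"
    using set_of_in_H[of "?U (?U C)" \<theta> X] C(1,2) inf
    by (simp_all add: tset_pairing_closure pairing_closure_lesspoll)
  have X_iff: "vpair p (vpair \<tau> x) \<in> X \<longleftrightarrow> p \<in> C \<and> \<tau> \<in> C \<and> x \<in> C \<and> forces_val P R p \<tau> x" for p \<tau> x
    unfolding X_def by auto
  have "val_witness (H \<theta>) P R (set_of X)"
    unfolding val_witness_def W(2) X_iff
  proof (intro ballI impI conjI)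
    fix p \<tau> x \<pi> s q
    assume *: "p \<in> C \<and> \<tau> \<in> C \<and> x \<in> C \<and> forces_val P R p \<tau> x" "vpair \<pi> s \<in> elts \<tau>" "q \<in> elts P"
      "vpair q p \<in> elts R \<and> vpair q s \<in> elts R"
    then obtain r y where r: "r \<in> elts P" "le R r q" "y \<in> elts x" "forces_val P R r \<pi> y"
      using forces_valD1[of P R p \<tau> x \<pi> s q] unfolding le_def by blast
    moreover have "\<pi> \<in> C" using CE[OF *(2)] *(1) vpair_in_tset[OF C(1)] by blast
    moreover have "r \<in> C" "y \<in> C" using CE r C(3) *(1) by blast+
    ultimately show "\<exists>r\<in>H \<theta>. r \<in> elts P \<and> vpair r q \<in> elts R \<and>
         (\<exists>y\<in>H \<theta>. y \<in> elts x \<and> r \<in> C \<and> \<pi> \<in> C \<and> y \<in> C \<and> forces_val P R r \<pi> y)"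
      using CH unfolding le_def by blast
  next
    fix p \<tau> x y q
    assume *: "p \<in> C \<and> \<tau> \<in> C \<and> x \<in> C \<and> forces_val P R p \<tau> x" "y \<in> elts x" "q \<in> elts P"
      "vpair q p \<in> elts R"
    then obtain r \<pi> s where r: "r \<in> elts P" "le R r q" "vpair \<pi> s \<in> elts \<tau>" "le R r s" "forces_val P R r \<pi> y"
      using forces_valD2[of P R p \<tau> x y q] unfolding le_def by blast
    moreover have "\<pi> \<in> C" "s \<in> C" using CE[OF r(3)] *(1) vpair_in_tset[OF C(1)] by blast+
    moreover have "r \<in> C" "y \<in> C" using CE r(1) C(3) * by blast+
    ultimately show "\<exists>r\<in>H \<theta>. r \<in> elts P \<and> vpair r q \<in> elts R \<and>
         (\<exists>\<pi>\<in>H \<theta>. \<exists>s\<in>H \<theta>. vpair \<pi> s \<in> elts \<tau> \<and> vpair r s \<in> elts R \<and>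
            r \<in> C \<and> \<pi> \<in> C \<and> y \<in> C \<and> forces_val P R r \<pi> y)"
      using CH unfolding le_def by blast
  qed
  moreover have "vpair p (vpair \<tau> x) \<in> elts (set_of X)"
    unfolding W(2) X_iff using C val by blast
  ultimately show ?thesis using W(1) by blast
qed

lemma definable_forces_val:
  assumes "infinite (elts \<theta>)"
  shows "definable (H \<theta>) (\<lambda>e. forces_val (e a) (e b) (e i) (e j) (e k))"
proof (rule definable_cong)
  show "definable (H \<theta>) (\<lambda>e. \<exists>W\<in>H \<theta>. vpair (e i) (vpair (e j) (e k)) \<in> elts W \<and>
      val_witness (H \<theta>) (e a) (e b) W)"
    unfolding val_witness_def
    by (intro definable_intros definable_pair_mem definable_triple_mem tset_H)
next
  fix e :: "nat \<Rightarrow> 'a hset"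
  assume "range e \<subseteq> H \<theta>"
  then have "e l \<in> H \<theta>" for l by auto
  then show "(\<exists>W\<in>H \<theta>. vpair (e i) (vpair (e j) (e k)) \<in> elts W \<and>
      val_witness (H \<theta>) (e a) (e b) W) \<longleftrightarrow> forces_val (e a) (e b) (e i) (e j) (e k)"
    using forces_val_if_witness[OF tset_H] forces_val_witness_exists[OF assms] by metis
qed

section \<open>Countable elements of elementary submodels\<close>

text \<open>An enumeration of \<open>M\<close> is indexed by the numerals \<open>n + 1 = {n}\<close>: that every index is empty or the
  singleton of another index is first-order, and by \<open>\<in>\<close>-induction puts all indices into \<open>N\<close>.\<close>

primrec zermelo :: "nat \<Rightarrow> 'k hset" where
  "zermelo 0 = set_of {}"
| "zermelo (Suc n) = set_of {zermelo n}"

lemma tset_zermelo: "tset (range zermelo)"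
proof -
  have "elts (zermelo n) \<subseteq> range zermelo" for n
    by (cases n) (auto simp: elts_finite)
  then show ?thesis unfolding tset_def by blast
qed

lemma zermelo_inj: "zermelo m = zermelo n \<longleftrightarrow> m = n"
proof (induction m arbitrary: n)
  case 0
  then show ?case by (cases n) (metis elts_finite empty_not_insert finite.emptyI finite.insertI zermelo.simps)+
next
  case (Suc m)
  show ?case
  proof (cases n)
    case 0
    then show ?thesis by (metis elts_finite empty_not_insert finite.emptyI finite.insertI nat.simps(3) zermelo.simps)
  next
    case (Suc l)
    have "set_of {a} = set_of {b} \<longleftrightarrow> a = b" for a b :: "'a hset"
      by (metis elts_finite finite.emptyI finite.insertI singleton_insert_inj_eq)
    then show ?thesis using Suc.IH[of l] Suc by simp
  qed
qed

text \<open>The enumeration that elementarity yields in \<open>N\<close> need not be the one built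
  here. Its indices are in \<open>N\<close> by induction, as each is determined by its only element;
  a value is then the unique one at an index in \<open>N\<close>.\<close>

lemma countable_elem_subset:
  assumes inf: "infinite (elts \<theta>)" and unc: "(UNIV :: nat set) \<prec> elts \<theta>"
    and N: "elementary N (H \<theta>)" and M: "M \<in> N" "countable (elts M)"
  shows "elts M \<subseteq> N"
proof (cases "elts M = {}")
  case False
  let ?A = "H \<theta>"
  let ?num = "\<lambda>f n. (\<forall>y\<in>?A. y \<notin> elts n) \<or>
    (\<exists>m\<in>?A. (\<forall>y\<in>?A. y \<in> elts n \<longleftrightarrow> y = m) \<and> (\<exists>x\<in>?A. vpair m x \<in> elts f))"
  let ?Q = "\<lambda>e. (\<forall>x\<in>?A. x \<in> elts (e (Suc 0)) \<longrightarrow> (\<exists>n\<in>?A. vpair n x \<in> elts (e 0))) \<and>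
    (\<forall>n\<in>?A. \<forall>x\<in>?A. vpair n x \<in> elts (e 0) \<longrightarrow> ?num (e 0) n \<and>
       (\<forall>x'\<in>?A. vpair n x' \<in> elts (e 0) \<longrightarrow> x' = x))"
  have NA: "N \<subseteq> ?A" using N unfolding elementary_def by blast
  have AE: "y \<in> ?A" if "y \<in> elts x" "x \<in> ?A" for x y
    using tset_H that unfolding tset_def by blast
  have MA: "M \<in> ?A" using M NA by blast
  obtain B where B: "tset B" "M \<in> B" "B \<prec> elts \<theta>" using H_iff[OF inf] MA by blast
  \<comment> \<open>The indices are adjoined to a transitive set around \<open>M\<close>; by
    \<open>unc\<close> the result stays below \<open>\<theta>\<close>.\<close>
  define C where "C = B \<union> range zermelo"
  have C: "tset C" "C \<prec> elts \<theta>"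
  proof -
    show "tset C" using B(1) tset_zermelo unfolding C_def tset_def by blast
    show "C \<prec> elts \<theta>"
      unfolding C_def using B(3) inf lesspoll_trans1[OF image_lepoll unc] by (intro lesspoll_Un)
  qed
  have CH: "z \<in> ?A" if "z \<in> C" for z
    using H_iff[OF inf] C that by blast
  \<comment> \<open>Repetitions do no harm: only the value at each index has to be unique.\<close>
  define en where "en = from_nat_into (elts M)"
  have en: "range en = elts M" unfolding en_def using M(2) False by (rule range_from_nat_into[rotated])
  define X where "X = range (\<lambda>n. vpair (zermelo n) (en n))"
  have sub: "elts M \<subseteq> C" "range zermelo \<subseteq> C" using B(1,2) unfolding C_def tset_def by blast+
  have "X \<subseteq> pairing_closure (pairing_closure C)"
    unfolding X_def using sub en by (intro image_subsetI vpair_in_pairing_closure) auto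
  then have W: "set_of X \<in> H \<theta>" "elts (set_of X) = X"
    using set_of_in_H[of "pairing_closure (pairing_closure C)" \<theta> X] C(1,2) inf
    by (simp_all add: tset_pairing_closure pairing_closure_lesspoll)
  have X_iff: "vpair n x \<in> X \<longleftrightarrow> (\<exists>i. n = zermelo i \<and> x = en i)" for n x
    unfolding X_def by auto
  have def_Q: "definable ?A ?Q"
    by (intro definable_intros definable_pair_mem tset_H)
  have zA: "zermelo i \<in> ?A" "en i \<in> ?A" for i
    using sub en by (blast intro: CH)+
  have num: "?num (set_of X) (zermelo i)" for i
  proof (cases i)
    case 0
    then show ?thesis by (simp add: elts_finite)
  next
    case (Suc j)
    have "vpair (zermelo j) (en j) \<in> elts (set_of X)" unfolding W(2) X_iff by blast
    moreover have "\<forall>y\<in>?A. y \<in> elts (zermelo i) \<longleftrightarrow> y = zermelo j"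
      unfolding Suc by (simp add: elts_finite)
    ultimately show ?thesis using zA by blast
  qed
  have "?Q (case_nat (set_of X) (\<lambda>_. M))"
    unfolding nat.case W(2)
  proof (intro conjI ballI impI)
    fix x assume "x \<in> elts M"
    then obtain i where "x = en i" using en by blast
    then show "\<exists>n\<in>?A. vpair n x \<in> X" using zA X_iff by blast
  next
    fix n x assume "vpair n x \<in> X"
    then show "(\<forall>y\<in>?A. y \<notin> elts n) \<or>
      (\<exists>m\<in>?A. (\<forall>y\<in>?A. y \<in> elts n \<longleftrightarrow> y = m) \<and> (\<exists>x\<in>?A. vpair m x \<in> X))"
      using num unfolding X_iff W(2) by blast
  next
    fix n x x' assume "vpair n x \<in> X" "vpair n x' \<in> X"
    then show "x' = x" unfolding X_iff zermelo_inj[symmetric] by (auto simp: zermelo_inj)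
  qed
  from elementary_witness[OF N def_Q _ W(1) this] M(1)
  obtain f where f: "f \<in> N" "?Q (case_nat f (\<lambda>_. M))" by auto
  have f1: "\<exists>n\<in>?A. vpair n x \<in> elts f" if "x \<in> elts M" for x
    using f(2) that AE MA by auto
  have f2: "?num f n" "\<And>x'. vpair n x' \<in> elts f \<Longrightarrow> x' = x" if "vpair n x \<in> elts f" for n x
  proof -
    have in_A: "n' \<in> ?A \<and> x' \<in> ?A" if "vpair n' x' \<in> elts f" for n' x'
      using vpair_in_tset[OF tset_H] AE[OF that] f(1) NA by blast
    have *: "?num f n \<and> (\<forall>x'\<in>?A. vpair n x' \<in> elts f \<longrightarrow> x' = x)"
      using conjunct2[OF f(2), rule_format, of n x] in_A[OF that] that by simp
    show "?num f n" using * by blast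
    show "\<And>x'. vpair n x' \<in> elts f \<Longrightarrow> x' = x" using * in_A by blast
  qed
  have nN: "n \<in> N" if "vpair n x \<in> elts f" for n x
    using that
  proof (induction n arbitrary: x rule: hset_induct)
    case (1 n)
    have nA: "n \<in> ?A" using vpair_in_tset[OF tset_H] AE[OF 1(2)] f(1) NA by blast
    from f2(1)[OF 1(2)] show ?case
    proof
      assume "\<forall>y\<in>?A. y \<notin> elts n"
      then have "elts n = {}" using AE nA by blast
      \<comment> \<open>The property determines its object by extensionality, so the witness found
        in \<open>N\<close> is \<open>n\<close> itself; likewise for the singleton below.\<close>
      have "\<exists>n\<in>N. \<forall>y\<in>?A. y \<notin> elts (case_nat n (\<lambda>_. M) 0)"
        by (rule elementary_witness[OF N _ _ nA, where Q = "\<lambda>e. \<forall>y\<in>?A. y \<notin> elts (e 0)"])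
         (use M \<open>\<forall>y\<in>?A. y \<notin> elts n\<close> in \<open>auto intro!: definable_intros\<close>)
      then obtain n' where n': "n' \<in> N" "\<forall>y\<in>?A. y \<notin> elts n'" by auto
      then have "elts n' = {}" using AE NA by blast
      then show ?case using n' \<open>elts n = {}\<close> by (metis hset_ext)
    next
      assume "\<exists>m\<in>?A. (\<forall>y\<in>?A. y \<in> elts n \<longleftrightarrow> y = m) \<and> (\<exists>x\<in>?A. vpair m x \<in> elts f)"
      then obtain m x' where m: "m \<in> ?A" "\<forall>y\<in>?A. y \<in> elts n \<longleftrightarrow> y = m" "vpair m x' \<in> elts f"
        by blast
      have "elts n = {m}" using m AE nA by blast
      have "m \<in> N" using 1(1) m by blast
      have "\<exists>n\<in>N. \<forall>y\<in>?A. y \<in> elts (case_nat n (\<lambda>_. m) 0) \<longleftrightarrow> y = case_nat n (\<lambda>_. m) (Suc 0)"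
        by (rule elementary_witness[OF N _ _ nA, where Q = "\<lambda>e. \<forall>y\<in>?A. y \<in> elts (e 0) \<longleftrightarrow> y = e (Suc 0)"])
         (use \<open>m \<in> N\<close> m in \<open>auto intro!: definable_intros\<close>)
      then obtain n' where n': "n' \<in> N" "\<forall>y\<in>?A. y \<in> elts n' \<longleftrightarrow> y = m" by auto
      then have "elts n' = {m}" using AE NA m(1) by blast
      then show ?case using n' \<open>elts n = {m}\<close> by (metis hset_ext)
    qed
  qed
  show ?thesis
  proof
    fix x assume "x \<in> elts M"
    then obtain n where n: "vpair n x \<in> elts f" using f1 by blast
    have "x \<in> ?A" using \<open>x \<in> elts M\<close> AE MA by blast
    have "\<exists>x\<in>N. vpair (case_nat x (case_nat n (\<lambda>_. f)) (Suc 0)) (case_nat x (case_nat n (\<lambda>_. f)) 0)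
        \<in> elts (case_nat x (case_nat n (\<lambda>_. f)) (Suc (Suc 0)))"
      by (rule elementary_witness[OF N _ _ \<open>x \<in> ?A\<close>,
            where Q = "\<lambda>e. vpair (e (Suc 0)) (e 0) \<in> elts (e (Suc (Suc 0)))"])
        (use n nN[OF n] f(1) in \<open>auto intro!: definable_pair_mem tset_H split: nat.splits\<close>)
    then obtain x' where "x' \<in> N" "vpair n x' \<in> elts f" by auto
    then show "x \<in> N" using f2(2)[OF n] by blast
  qed
qed simp

section \<open>Closure points below \<open>\<omega>\<^sub>2\<close>\<close>

lemma elts_irrefl: "x \<notin> elts x"
  using wf_elts wf_not_refl by fastforce

lemma elts_asym: "x \<in> elts y \<Longrightarrow> y \<notin> elts x"
  using wf_not_sym[OF wf_elts, of x y] by simp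

lemma Ord_trans: "Ord \<alpha> \<Longrightarrow> \<beta> \<in> elts \<alpha> \<Longrightarrow> \<gamma> \<in> elts \<beta> \<Longrightarrow> \<gamma> \<in> elts \<alpha>"
  unfolding Ord_def transitive_def by blast

lemma Ord_elt: "Ord \<alpha> \<Longrightarrow> \<beta> \<in> elts \<alpha> \<Longrightarrow> Ord \<beta>"
  using Ord_def Ord_trans by metis

lemma Ord_linear: "Ord \<alpha> \<Longrightarrow> Ord \<beta> \<Longrightarrow> \<alpha> \<in> elts \<beta> \<or> \<alpha> = \<beta> \<or> \<beta> \<in> elts \<alpha>"
proof (induction \<alpha> arbitrary: \<beta> rule: hset_induct)
  case (1 \<alpha>)
  note IH = 1(1) and Ord = 1(2)
  from 1(3) show ?case
  proof (induction \<beta> rule: hset_induct)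
    case (1 \<beta>)
    show ?case
    proof (rule ccontr)
      assume neg: "\<not> ?case"
      have "x \<in> elts \<beta>" if "x \<in> elts \<alpha>" for x
        using IH[OF that Ord_elt[OF Ord that] 1(2)] Ord_trans[OF Ord that] neg that by blast
      moreover have "y \<in> elts \<alpha>" if "y \<in> elts \<beta>" for y
        using 1(1)[OF that Ord_elt[OF 1(2) that]] Ord_trans[OF 1(2) that] neg that by blast
      ultimately have "elts \<alpha> = elts \<beta>" by blast
      then show False using neg by (simp add: hset_ext)
    qed
  qed
qed

lemma Ord_if_Union:
  assumes "elts \<alpha> = (\<Union>x\<in>X. elts x)" "\<And>x. x \<in> X \<Longrightarrow> Ord x"
  shows "Ord \<alpha>"
proof -
  have "elts y \<subseteq> elts \<alpha> \<and> transitive y" if y: "y \<in> elts \<alpha>" for y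
  proof -
    obtain x where x: "x \<in> X" "y \<in> elts x" using y assms(1) by blast
    have "Ord x" by (rule assms(2)[OF x(1)])
    then have "elts y \<subseteq> elts x" "transitive y"
      using Ord_trans[OF _ x(2)] Ord_elt[OF _ x(2)] by (blast, simp add: Ord_def)
    then show ?thesis using assms(1) x(1) by blast
  qed
  then show ?thesis unfolding Ord_def transitive_def by blast
qed

lemma Ord_vsucc: "Ord \<alpha> \<Longrightarrow> Ord (vsucc \<alpha>)"
  unfolding Ord_def transitive_def by (auto simp: elts_vsucc)

lemma Ord_omega1: "Ord omega1"
proof -
  have "\<gamma> \<in> elts omega1" if "\<beta> \<in> elts omega1" "\<gamma> \<in> elts \<beta>" for \<beta> \<gamma> :: "'a hset"
    using vsucc_omega1[OF that(1)] that(2) by (auto simp: elts_vsucc)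
  then have "transitive (omega1 :: 'a hset)" unfolding transitive_def by blast
  then show ?thesis unfolding Ord_def[of omega1] by (simp add: elts_omega1 Ord_def)
qed

text \<open>Otherwise \<open>omega1\<close> would be a countable ordinal and so a member of
  itself.\<close>

lemma infinite_omega1: "infinite (elts (omega1 :: 'k hset))"
proof
  assume "finite (elts (omega1 :: 'k hset))"
  then have "(omega1 :: 'k hset) \<in> elts omega1"
    using Ord_omega1 by (subst elts_omega1) (simp add: countable_finite)
  then show False using elts_irrefl by blast
qed

text \<open>For each n, \<open>lepoll_Ord\<close> embeds the ordinals with at most n elements into a
  finite power set.\<close>

lemma countable_omega: "countable (elts (omega :: 'k hset))"
proof -
  have "elts (omega :: 'k hset) \<subseteq> (\<Union>n. {\<alpha>. Ord \<alpha> \<and> elts \<alpha> \<lesssim> {..<n::nat}})"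
    by (auto simp: elts_omega lepoll_iff_finite_card)
  moreover have "countable {\<alpha> :: 'k hset. Ord \<alpha> \<and> elts \<alpha> \<lesssim> {..<n::nat}}" for n
    using countable_lepoll[OF countable_finite lepoll_Ord[of "{..<n}"]] by simp
  ultimately show ?thesis by (meson countable_UN countable_subset countableI_type)
qed

lemma UN_lepoll:
  assumes "infinite B" "I \<lesssim> B" "\<And>i. i \<in> I \<Longrightarrow> A i \<lesssim> B"
  shows "(\<Union>i\<in>I. A i) \<lesssim> B"
  using card_of_UNION_ordLeq_infinite[OF assms(1), of I A] assms(2,3)
  unfolding lepoll_def card_of_ordLeq by blast

lemma lists_lepoll:
  assumes "infinite A"
  shows "lists A \<lesssim> A"
proof -
  have "{l \<in> lists A. length l = n} \<lesssim> A" for n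
  proof (induction n)
    case 0
    have "{l \<in> lists A. length l = 0} = {[]}" by auto
    then show ?case using assms by (simp add: finite_lepoll_infinite)
  next
    case (Suc n)
    have "{l \<in> lists A. length l = Suc n} \<subseteq> case_prod Cons ` (A \<times> {l \<in> lists A. length l = n})"
      by (auto simp: length_Suc_conv)
    then have "{l \<in> lists A. length l = Suc n} \<lesssim> A \<times> {l \<in> lists A. length l = n}"
      by (rule subset_image_lepoll)
    also have "\<dots> \<lesssim> A \<times> A" using Suc by (intro times_lepoll_mono) simp_all
    also have "\<dots> \<lesssim> A" by (rule infinite_times_lepoll[OF assms])
    finally show ?case .
  qed
  moreover have "(UNIV :: nat set) \<lesssim> A" using assms infinite_le_lepoll by blast
  ultimately have "(\<Union>n. {l \<in> lists A. length l = n}) \<lesssim> A" by (intro UN_lepoll assms)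
  moreover have "(\<Union>n. {l \<in> lists A. length l = n}) = lists A" by auto
  ultimately show ?thesis by simp
qed

lemma insert_lepoll_infinite:
  assumes "infinite B" "A \<lesssim> B"
  shows "insert a A \<lesssim> B"
proof (cases "finite A")
  case True
  then show ?thesis using assms(1) by (simp add: finite_lepoll_infinite)
next
  case False
  then show ?thesis by (rule lepoll_trans[OF infinite_insert_lepoll assms(2)])
qed

lemma vsucc_omega2:
  assumes "\<alpha> \<in> elts (omega2 :: 'k hset)"
  shows "vsucc \<alpha> \<in> elts omega2"
  using assms by (simp add: elts_omega2 elts_vsucc Ord_vsucc insert_lepoll_infinite infinite_omega1)

lemma omega2_trans:
  assumes "\<alpha> \<in> elts (omega2 :: 'k hset)"
  shows "elts \<alpha> \<subseteq> elts omega2"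
proof
  fix \<beta> assume \<beta>: "\<beta> \<in> elts \<alpha>"
  have \<alpha>: "Ord \<alpha>" "elts \<alpha> \<lesssim> elts (omega1 :: 'k hset)" using assms by (simp_all add: elts_omega2)
  have "elts \<beta> \<subseteq> elts \<alpha>" using Ord_trans[OF \<alpha>(1) \<beta>] by blast
  from lepoll_trans[OF subset_imp_lepoll[OF this] \<alpha>(2)] show "\<beta> \<in> elts omega2"
    using Ord_elt[OF \<alpha>(1) \<beta>] by (simp add: elts_omega2)
qed

text \<open>Regularity of \<open>omega2\<close>: a union of at most \<open>omega1\<close> many sets
  of size at most \<open>omega1\<close> has size at most \<open>omega1\<close>.\<close>

lemma sup_omega2:
  assumes "X \<subseteq> elts (omega2 :: 'k hset)" "X \<lesssim> elts (omega1 :: 'k hset)"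
  shows "set_of (\<Union>x\<in>X. elts x) \<in> elts omega2" "elts (set_of (\<Union>x\<in>X. elts x)) = (\<Union>x\<in>X. elts x)"
proof -
  have small: "(\<Union>x\<in>X. elts x) \<lesssim> elts (omega1 :: 'k hset)"
    using assms by (intro UN_lepoll infinite_omega1) (auto simp: elts_omega2)
  then show eq: "elts (set_of (\<Union>x\<in>X. elts x)) = (\<Union>x\<in>X. elts x)"
    using small_iff lepoll_trans by (metis elts_set_of)
  show "set_of (\<Union>x\<in>X. elts x) \<in> elts omega2"
    unfolding elts_omega2 mem_Collect_eq eq
    using small Ord_if_Union[OF eq] assms(1) by (auto simp: elts_omega2)
qed

lemma lists_Union_chain:
  assumes "\<And>n. A n \<subseteq> A (Suc n)" "s \<in> lists (\<Union>n. A n)"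
  shows "\<exists>n::nat. s \<in> lists (A n)"
  using assms(2)
proof (induction s)
  case (Cons x s)
  then obtain m n where "x \<in> A m" "s \<in> lists (A n)" by auto
  moreover have "A i \<subseteq> A j" if "i \<le> j" for i j
    using that assms(1) by (rule lift_Suc_mono_le[rotated])
  then have "A m \<subseteq> A (max m n)" "A n \<subseteq> A (max m n)" by simp_all
  ultimately show ?case by (intro exI[of _ "max m n"]) auto
qed simp

text \<open>For unboundedness, countably many rounds of closing off suffice, each with at most
  \<open>omega1\<close> many finite sequences. For closure, a finite sequence below a limit
  \<open>\<gamma>\<close> already lies below one closure point under
  \<open>\<gamma>\<close>.\<close>

lemma club_closure_points:
  fixes F :: "'k hset list \<Rightarrow> 'k hset"
  assumes F: "\<And>s. s \<in> lists (elts omega2) \<Longrightarrow> F s \<in> elts omega2"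
  shows "club omega2 {\<alpha>\<in>elts omega2. \<forall>s\<in>lists (elts \<alpha>). F s \<in> elts \<alpha>}" (is "club _ ?C")
  unfolding club_def
proof (intro conjI ballI impI)
  fix \<xi> :: "'k hset" assume \<xi>: "\<xi> \<in> elts omega2"
  \<comment> \<open>The next stage is a union of ordinals; taking successors puts \<open>F s\<close>
    itself strictly below it, and likewise \<open>\<alpha>\<close>.\<close>
  define X where "X = (\<lambda>\<alpha>. insert (vsucc \<alpha>) ((\<lambda>s. vsucc (F s)) ` lists (elts \<alpha>)))"
  define g where "g = (\<lambda>\<alpha>. set_of (\<Union>x\<in>X \<alpha>. elts x))"
  have g: "g \<alpha> \<in> elts omega2" "elts (g \<alpha>) = (\<Union>x\<in>X \<alpha>. elts x)" if \<alpha>: "\<alpha> \<in> elts omega2" for \<alpha>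
  proof -
    have "elts \<alpha> \<subseteq> elts omega2" by (rule omega2_trans[OF \<alpha>])
    then have "F s \<in> elts omega2" if "s \<in> lists (elts \<alpha>)" for s
      using that by (intro F) auto
    then have sub: "X \<alpha> \<subseteq> elts omega2"
      unfolding X_def using \<alpha> by (auto intro: vsucc_omega2)
    have "lists (elts \<alpha>) \<lesssim> lists (elts (omega1 :: 'k hset))"
      using \<alpha> by (intro lists_lepoll_mono) (simp add: elts_omega2)
    then have "lists (elts \<alpha>) \<lesssim> elts (omega1 :: 'k hset)"
      using lists_lepoll[OF infinite_omega1] by (rule lepoll_trans)
    then have "(\<lambda>s. vsucc (F s)) ` lists (elts \<alpha>) \<lesssim> elts (omega1 :: 'k hset)"
      by (rule lepoll_trans[OF image_lepoll])
    then have "X \<alpha> \<lesssim> elts (omega1 :: 'k hset)"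
      unfolding X_def by (rule insert_lepoll_infinite[OF infinite_omega1])
    from sup_omega2[OF sub this] show "g \<alpha> \<in> elts omega2" "elts (g \<alpha>) = (\<Union>x\<in>X \<alpha>. elts x)"
      unfolding g_def by blast+
  qed
  define a where "a = (\<lambda>n::nat. (g ^^ n) (vsucc \<xi>))"
  have a: "a n \<in> elts omega2" for n
    unfolding a_def by (induction n) (auto simp: g \<xi> vsucc_omega2)
  have a_Suc: "elts (a (Suc n)) = (\<Union>x\<in>X (a n). elts x)" for n
    using g(2)[OF a] unfolding a_def by simp
  have mono: "elts (a n) \<subseteq> elts (a (Suc n))" for n
    unfolding a_Suc X_def by (auto simp: elts_vsucc)
  define \<alpha> where "\<alpha> = set_of (\<Union>x\<in>range a. elts x)"
  have "range a \<lesssim> (UNIV :: nat set)" by (rule image_lepoll)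
  also have "(UNIV :: nat set) \<lesssim> elts (omega1 :: 'k hset)"
    using infinite_omega1 infinite_le_lepoll by blast
  finally have "range a \<lesssim> elts (omega1 :: 'k hset)" .
  then have \<alpha>: "\<alpha> \<in> elts omega2" "elts \<alpha> = (\<Union>n. elts (a n))"
    using sup_omega2[of "range a"] a unfolding \<alpha>_def by auto
  have "F s \<in> elts \<alpha>" if s: "s \<in> lists (elts \<alpha>)" for s
  proof -
    obtain n where "s \<in> lists (elts (a n))"
      using lists_Union_chain[of "\<lambda>n. elts (a n)", OF mono] s unfolding \<alpha>(2) by blast
    then have "F s \<in> elts (a (Suc n))" unfolding a_Suc X_def by (auto simp: elts_vsucc)
    then show ?thesis using \<alpha>(2) by blast
  qed
  moreover have "\<xi> \<in> elts (a 0)" unfolding a_def by (simp add: elts_vsucc)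
  then have "\<xi> \<in> elts \<alpha>" using \<alpha>(2) by blast
  ultimately show "\<exists>\<eta>\<in>?C. \<xi> \<in> elts \<eta>" using \<alpha>(1) by blast
next
  fix \<gamma> :: "'k hset"
  assume \<gamma>: "\<gamma> \<in> elts omega2" "Limit \<gamma> \<and> (\<forall>\<xi>\<in>elts \<gamma>. \<exists>\<eta>\<in>?C \<inter> elts \<gamma>. \<xi> \<in> elts \<eta>)"
  then have Ord: "Ord \<gamma>" by (simp add: elts_omega2)
  have bound: "\<exists>\<eta>\<in>?C \<inter> elts \<gamma>. s \<in> lists (elts \<eta>)" if "s \<in> lists (elts \<gamma>)" for s
    using that
  proof (induction s)
    case Nil
    \<comment> \<open>Even the empty sequence needs a closure point below \<open>\<gamma>\<close>;
      one exists because \<open>Limit\<close> excludes 0.\<close>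
    obtain \<xi> where "\<xi> \<in> elts \<gamma>" using \<gamma>(2) unfolding Limit_def by blast
    then show ?case using \<gamma>(2) by blast
  next
    case (Cons x s)
    then obtain \<eta> where \<eta>: "\<eta> \<in> ?C \<inter> elts \<gamma>" "s \<in> lists (elts \<eta>)" by auto
    obtain \<eta>' where \<eta>': "\<eta>' \<in> ?C \<inter> elts \<gamma>" "x \<in> elts \<eta>'" using Cons \<gamma>(2) by auto
    have "Ord \<eta>" "Ord \<eta>'" using \<eta>(1) \<eta>'(1) by (simp_all add: elts_omega2)
    then consider "elts \<eta> \<subseteq> elts \<eta>'" | "elts \<eta>' \<subseteq> elts \<eta>"
      using Ord_linear[of \<eta> \<eta>'] Ord_trans[of \<eta> \<eta>'] Ord_trans[of \<eta>' \<eta>] by blast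
    then show ?case
    proof cases
      case 1
      then have "x # s \<in> lists (elts \<eta>')" using \<eta>(2) \<eta>'(2) by auto
      then show ?thesis using \<eta>'(1) by blast
    next
      case 2
      then have "x # s \<in> lists (elts \<eta>)" using \<eta>(2) \<eta>'(2) by auto
      then show ?thesis using \<eta>(1) by blast
    qed
  qed
  show "\<gamma> \<in> ?C"
  proof (intro CollectI conjI ballI \<gamma>(1))
    fix s assume "s \<in> lists (elts \<gamma>)"
    then obtain \<eta> where \<eta>: "\<eta> \<in> ?C \<inter> elts \<gamma>" "s \<in> lists (elts \<eta>)" using bound by blast
    then show "F s \<in> elts \<gamma>" using Ord_trans[OF Ord] by blast
  qed
qed blast

lemma stationary_closure_point:
  assumes "stationary omega2 S" "\<And>s. s \<in> lists (elts omega2) \<Longrightarrow> F s \<in> elts omega2"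
  obtains \<alpha> where "\<alpha> \<in> elts S" "\<And>s. s \<in> lists (elts \<alpha>) \<Longrightarrow> F s \<in> elts \<alpha>"
  using assms(1) club_closure_points[of F, OF assms(2)] unfolding stationary_def by blast

section \<open>Distributivity of \<open>P[S]\<close>\<close>

text \<open>\<open>F\<close> is a total HOL function with arbitrary values off
  \<open>vsucc \<beta>\<close>; this keeps the work on values apart from the coding by
  \<open>vfun\<close>.\<close>

definition shoot_map :: "'k hset \<Rightarrow> 'k hset \<Rightarrow> ('k hset \<Rightarrow> 'k hset) \<Rightarrow> bool" where
  "shoot_map S \<beta> F \<longleftrightarrow> \<beta> \<in> elts omega1 \<and> F ` elts (vsucc \<beta>) \<subseteq> elts S \<and>
     (\<forall>\<eta>\<in>elts (vsucc \<beta>). \<forall>\<xi>\<in>elts \<eta>. F \<xi> \<in> elts (F \<eta>)) \<and>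
     (\<forall>\<gamma>\<in>elts (vsucc \<beta>). Limit \<gamma> \<longrightarrow> elts (F \<gamma>) = (\<Union>\<xi>\<in>elts \<gamma>. elts (F \<xi>)))"

lemma shoot_conditions_eq: "shoot_conditions S = {vfun (vsucc \<beta>) F | \<beta> F. shoot_map S \<beta> F}"
  unfolding shoot_conditions_def shoot_map_def by blast

lemma vfun_subset_iff:
  "elts (vfun d F) \<subseteq> elts (vfun d' F') \<longleftrightarrow> elts d \<subseteq> elts d' \<and> (\<forall>x\<in>elts d. F x = F' x)"
  unfolding elts_vfun by auto

lemma not_Limit_vsucc: "\<not> Limit (vsucc \<beta>)"
proof
  assume "Limit (vsucc \<beta>)"
  then obtain \<eta> where "\<eta> \<in> elts (vsucc \<beta>)" "\<beta> \<in> elts \<eta>"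
    unfolding Limit_def by (auto simp: elts_vsucc)
  then show False using elts_irrefl elts_asym by (auto simp: elts_vsucc)
qed

lemma vsucc_in_omega1: "\<beta> \<in> elts omega1 \<Longrightarrow> vsucc \<beta> \<in> elts omega1"
  by (simp add: elts_omega1 elts_vsucc Ord_vsucc)

lemma shoot_map_extend:
  assumes F: "shoot_map S \<beta> F" and \<alpha>: "\<alpha> \<in> elts S" "Ord \<alpha>" "F \<beta> \<in> elts \<alpha>"
  shows "shoot_map S (vsucc \<beta>) (F(vsucc \<beta> := \<alpha>))"
    and "elts (vfun (vsucc \<beta>) F) \<subset> elts (vfun (vsucc (vsucc \<beta>)) (F(vsucc \<beta> := \<alpha>)))"
proof -
  let ?G = "F(vsucc \<beta> := \<alpha>)"
  have \<beta>: "\<beta> \<in> elts omega1" "Ord \<beta>" using F by (auto simp: shoot_map_def elts_omega1)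
  have G: "?G x = F x" if "x \<in> elts (vsucc \<beta>)" for x
    using that elts_irrefl by auto
  have tr: "\<xi> \<in> elts (vsucc \<beta>)" if "\<eta> \<in> elts (vsucc \<beta>)" "\<xi> \<in> elts \<eta>" for \<xi> \<eta>
    using Ord_trans[OF Ord_vsucc[OF \<beta>(2)] that] .
  have below: "F \<xi> \<in> elts \<alpha>" if "\<xi> \<in> elts (vsucc \<beta>)" for \<xi>
  proof (cases "\<xi> = \<beta>")
    case False
    then have "F \<xi> \<in> elts (F \<beta>)"
      using F that unfolding shoot_map_def by (simp add: elts_vsucc)
    then show ?thesis using Ord_trans[OF \<alpha>(2,3)] by blast
  qed (use \<alpha> in simp)
  show "shoot_map S (vsucc \<beta>) ?G"
    unfolding shoot_map_def
  proof (intro conjI ballI impI)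
    show "vsucc \<beta> \<in> elts omega1" using \<beta> by (simp add: vsucc_in_omega1)
    show "?G ` elts (vsucc (vsucc \<beta>)) \<subseteq> elts S"
      using F \<alpha>(1) G unfolding shoot_map_def by (auto simp: elts_vsucc[of "vsucc \<beta>"])
  next
    fix \<eta> \<xi> assume *: "\<eta> \<in> elts (vsucc (vsucc \<beta>))" "\<xi> \<in> elts \<eta>"
    show "?G \<xi> \<in> elts (?G \<eta>)"
    proof (cases "\<eta> = vsucc \<beta>")
      case True
      then show ?thesis using *(2) below G by auto
    next
      case False
      then have \<eta>: "\<eta> \<in> elts (vsucc \<beta>)" using *(1) by (simp add: elts_vsucc[of "vsucc \<beta>"])
      then have "F \<xi> \<in> elts (F \<eta>)" using F *(2) unfolding shoot_map_def by blast
      then show ?thesis using G[OF \<eta>] G[OF tr[OF \<eta> *(2)]] by simp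
    qed
  next
    \<comment> \<open>The new last argument is a successor, so continuity makes no demand on
      \<open>\<alpha>\<close>.\<close>
    fix \<gamma> assume *: "\<gamma> \<in> elts (vsucc (vsucc \<beta>))" "Limit \<gamma>"
    then have \<gamma>: "\<gamma> \<in> elts (vsucc \<beta>)"
      using not_Limit_vsucc by (auto simp: elts_vsucc[of "vsucc \<beta>"])
    then have "elts (F \<gamma>) = (\<Union>\<xi>\<in>elts \<gamma>. elts (F \<xi>))"
      using F *(2) unfolding shoot_map_def by blast
    moreover have "(\<Union>\<xi>\<in>elts \<gamma>. elts (F \<xi>)) = (\<Union>\<xi>\<in>elts \<gamma>. elts (?G \<xi>))"
      using G[OF tr[OF \<gamma>]] by simp
    ultimately show "elts (?G \<gamma>) = (\<Union>\<xi>\<in>elts \<gamma>. elts (?G \<xi>))"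
      using G[OF \<gamma>] by simp
  qed
  have "elts (vfun (vsucc \<beta>) F) \<subseteq> elts (vfun (vsucc (vsucc \<beta>)) ?G)"
    unfolding vfun_subset_iff using G by (auto simp: elts_vsucc[of "vsucc \<beta>"])
  moreover have "\<not> elts (vsucc (vsucc \<beta>)) \<subseteq> elts (vsucc \<beta>)"
    using elts_irrefl by (auto simp: elts_vsucc[of "vsucc \<beta>"])
  ultimately show "elts (vfun (vsucc \<beta>) F) \<subset> elts (vfun (vsucc (vsucc \<beta>)) ?G)"
    using vfun_subset_iff[of "vsucc (vsucc \<beta>)" ?G "vsucc \<beta>" F] by blast
qed

text \<open>The union of the chain is closed off by the value \<open>\<alpha>\<close> at
  \<open>\<delta>\<close>, the supremum of the domains. Continuity there holds because the last
  values lie below \<open>\<alpha>\<close> and are cofinal in it.\<close>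

lemma shoot_map_limit:
  assumes F: "\<And>n. shoot_map S (\<beta> n) (F n)"
    and chain: "\<And>n. elts (vfun (vsucc (\<beta> n)) (F n)) \<subseteq> elts (vfun (vsucc (\<beta> (Suc n))) (F (Suc n)))"
    and \<alpha>: "\<alpha> \<in> elts S" "Ord \<alpha>"
    and below: "\<And>n::nat. F n (\<beta> n) \<in> elts \<alpha>"
    and cofinal: "\<And>\<zeta>. \<zeta> \<in> elts \<alpha> \<Longrightarrow> \<exists>n. \<zeta> \<in> elts (F n (\<beta> n))"
  obtains \<delta> G where "shoot_map S \<delta> G"
    "\<And>n. elts (vfun (vsucc (\<beta> n)) (F n)) \<subseteq> elts (vfun (vsucc \<delta>) G)"
proof -
  have \<beta>: "\<beta> n \<in> elts omega1" "Ord (\<beta> n)" for n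
    using F[of n] by (auto simp: shoot_map_def elts_omega1)
  have "elts (vfun (vsucc (\<beta> m)) (F m)) \<subseteq> elts (vfun (vsucc (\<beta> n)) (F n))" if "m \<le> n" for m n
    using that chain by (rule lift_Suc_mono_le[of "\<lambda>n. elts (vfun (vsucc (\<beta> n)) (F n))", rotated])
  then have mono: "elts (vsucc (\<beta> m)) \<subseteq> elts (vsucc (\<beta> n))"
      "\<And>x. x \<in> elts (vsucc (\<beta> m)) \<Longrightarrow> F m x = F n x" if "m \<le> n" for m n
    using that unfolding vfun_subset_iff by blast+
  have agree: "F m x = F n x" if "x \<in> elts (vsucc (\<beta> m))" "x \<in> elts (vsucc (\<beta> n))" for m n x
    using mono(2)[of m n x] mono(2)[of n m x] that nle_le by metis
  define \<delta> where "\<delta> = set_of (\<Union>n. elts (vsucc (\<beta> n)))"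
  have "countable (\<Union>n. elts (vsucc (\<beta> n)))"
    using \<beta> by (intro countable_UN) (auto simp: elts_omega1 elts_vsucc)
  moreover have eq: "elts \<delta> = (\<Union>n. elts (vsucc (\<beta> n)))"
  proof -
    have "(\<Union>n. elts (vsucc (\<beta> n))) \<subseteq> elts omega1" using vsucc_omega1 \<beta> by blast
    then show ?thesis
      unfolding \<delta>_def using lepoll_trans[OF subset_imp_lepoll] small_iff by (intro elts_set_of) blast
  qed
  moreover have "Ord \<delta>"
    by (rule Ord_if_Union[of _ "range (\<lambda>n. vsucc (\<beta> n))"]) (use eq in simp, auto intro: Ord_vsucc[OF \<beta>(2)])
  ultimately have \<delta>: "\<delta> \<in> elts omega1" "Ord \<delta>" by (simp_all add: elts_omega1)
  \<comment> \<open>By \<open>agree\<close> the choice of n is immaterial. The value at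
    \<open>\<delta>\<close> is free, as \<open>\<delta>\<close> lies in no
    \<open>vsucc (\<beta> n)\<close>.\<close>
  define G where "G = (\<lambda>x. if x = \<delta> then \<alpha> else F (SOME n. x \<in> elts (vsucc (\<beta> n))) x)"
  have G: "G x = F n x" if "x \<in> elts (vsucc (\<beta> n))" for x n
  proof -
    have "x \<in> elts \<delta>" using that eq by blast
    then have "x \<noteq> \<delta>" using elts_irrefl by blast
    then show ?thesis
      unfolding G_def using agree[OF someI[of "\<lambda>n. x \<in> elts (vsucc (\<beta> n))", OF that] that] by simp
  qed
  have G\<delta>: "G \<delta> = \<alpha>" unfolding G_def by simp
  have tr: "\<xi> \<in> elts (vsucc (\<beta> n))" if "\<eta> \<in> elts (vsucc (\<beta> n))" "\<xi> \<in> elts \<eta>" for \<xi> \<eta> n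
    using Ord_trans[OF Ord_vsucc[OF \<beta>(2)] that] .
  have G_below: "G \<xi> \<in> elts \<alpha>" if \<xi>: "\<xi> \<in> elts (vsucc (\<beta> n))" for \<xi> n
  proof (cases "\<xi> = \<beta> n")
    case False
    then have "F n \<xi> \<in> elts (F n (\<beta> n))"
      using F[of n] \<xi> unfolding shoot_map_def by (simp add: elts_vsucc)
    then show ?thesis using Ord_trans[OF \<alpha>(2) below] G[OF \<xi>] by simp
  qed (use below G[OF \<xi>] in simp)
  have top: "\<beta> n \<in> elts (vsucc (\<beta> n))" for n by (simp add: elts_vsucc)
  have "shoot_map S \<delta> G"
    unfolding shoot_map_def
  proof (intro conjI ballI impI)
    show "\<delta> \<in> elts omega1" by (rule \<delta>)
    show "G ` elts (vsucc \<delta>) \<subseteq> elts S"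
    proof
      fix y assume "y \<in> G ` elts (vsucc \<delta>)"
      then obtain x where x: "x \<in> elts (vsucc \<delta>)" "y = G x" by blast
      show "y \<in> elts S"
      proof (cases "x = \<delta>")
        case True
        then show ?thesis using x \<alpha> G\<delta> by simp
      next
        case False
        then obtain n where "x \<in> elts (vsucc (\<beta> n))" using x eq by (auto simp: elts_vsucc[of \<delta>])
        then show ?thesis using F[of n] x(2) G unfolding shoot_map_def by force
      qed
    qed
  next
    fix \<eta> \<xi> assume *: "\<eta> \<in> elts (vsucc \<delta>)" "\<xi> \<in> elts \<eta>"
    show "G \<xi> \<in> elts (G \<eta>)"
    proof (cases "\<eta> = \<delta>")
      case True
      then show ?thesis using *(2) G_below G\<delta> eq by auto
    next
      case False
      then obtain n where \<eta>: "\<eta> \<in> elts (vsucc (\<beta> n))" using *(1) eq by (auto simp: elts_vsucc[of \<delta>])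
      then have "F n \<xi> \<in> elts (F n \<eta>)" using F[of n] *(2) unfolding shoot_map_def by blast
      then show ?thesis using G[OF \<eta>] G[OF tr[OF \<eta> *(2)]] by simp
    qed
  next
    fix \<gamma> assume *: "\<gamma> \<in> elts (vsucc \<delta>)" "Limit \<gamma>"
    show "elts (G \<gamma>) = (\<Union>\<xi>\<in>elts \<gamma>. elts (G \<xi>))"
    proof (cases "\<gamma> = \<delta>")
      case True
      have "\<zeta> \<in> (\<Union>\<xi>\<in>elts \<delta>. elts (G \<xi>))" if "\<zeta> \<in> elts \<alpha>" for \<zeta>
      proof -
        obtain n where "\<zeta> \<in> elts (F n (\<beta> n))" using cofinal[OF \<open>\<zeta> \<in> elts \<alpha>\<close>] by blast
        then have "\<zeta> \<in> elts (G (\<beta> n))" using G[OF top] by simp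
        moreover have "\<beta> n \<in> elts \<delta>" using eq top by blast
        ultimately show ?thesis by blast
      qed
      moreover have "\<zeta> \<in> elts \<alpha>" if \<xi>: "\<xi> \<in> elts \<delta>" "\<zeta> \<in> elts (G \<xi>)" for \<xi> \<zeta>
      proof -
        obtain n where "\<xi> \<in> elts (vsucc (\<beta> n))" using \<xi>(1) eq by blast
        then show ?thesis using Ord_trans[OF \<alpha>(2) G_below \<xi>(2)] by blast
      qed
      ultimately show ?thesis unfolding True G\<delta> by blast
    next
      case False
      then obtain n where \<gamma>: "\<gamma> \<in> elts (vsucc (\<beta> n))" using *(1) eq by (auto simp: elts_vsucc[of \<delta>])
      then have "elts (F n \<gamma>) = (\<Union>\<xi>\<in>elts \<gamma>. elts (F n \<xi>))"
        using F[of n] *(2) unfolding shoot_map_def by blast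
      moreover have "(\<Union>\<xi>\<in>elts \<gamma>. elts (F n \<xi>)) = (\<Union>\<xi>\<in>elts \<gamma>. elts (G \<xi>))"
        using G[OF tr[OF \<gamma>]] by simp
      ultimately show ?thesis using G[OF \<gamma>] by simp
    qed
  qed
  moreover have "elts (vfun (vsucc (\<beta> n)) (F n)) \<subseteq> elts (vfun (vsucc \<delta>) G)" for n
    unfolding vfun_subset_iff using G eq by (auto simp: elts_vsucc[of \<delta>])
  ultimately show ?thesis using that by blast
qed

text \<open>One new point above both \<open>\<gamma>\<close> and the old last value is enough;
  stationarity supplies it as a closure point.\<close>

lemma shoot_unbounded:
  assumes "stationary omega2 S" "p \<in> shoot_conditions S" "\<gamma> \<in> elts omega2"
  obtains \<beta> F where "shoot_map S \<beta> F" "elts p \<subset> elts (vfun (vsucc \<beta>) F)" "\<gamma> \<in> elts (F \<beta>)"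
proof -
  obtain \<beta> F where F: "p = vfun (vsucc \<beta>) F" "shoot_map S \<beta> F"
    using assms(2) unfolding shoot_conditions_eq by blast
  have S: "elts S \<subseteq> elts omega2" using assms(1) unfolding stationary_def by blast
  then have "F \<beta> \<in> elts omega2" using F(2) unfolding shoot_map_def by (auto simp: elts_vsucc)
  \<comment> \<open>A function with two values: the empty sequence puts \<open>\<gamma>\<close>
    below \<open>\<alpha>\<close>, and then the sequence \<open>[\<gamma>]\<close> puts
    \<open>F \<beta>\<close> there.\<close>
  then obtain \<alpha> where \<alpha>: "\<alpha> \<in> elts S"
      "\<And>s. s \<in> lists (elts \<alpha>) \<Longrightarrow> (if s = [] then \<gamma> else F \<beta>) \<in> elts \<alpha>"
    using stationary_closure_point[OF assms(1), of "\<lambda>s. if s = [] then \<gamma> else F \<beta>"] assms(3) by metis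
  have "\<gamma> \<in> elts \<alpha>" using \<alpha>(2)[of "[]"] by simp
  moreover from this have "F \<beta> \<in> elts \<alpha>" using \<alpha>(2)[of "[\<gamma>]"] by simp
  moreover have "Ord \<alpha>" using \<alpha>(1) S by (auto simp: elts_omega2)
  ultimately show ?thesis
    using that[of "vsucc \<beta>" "F(vsucc \<beta> := \<alpha>)"] shoot_map_extend[OF F(2) \<alpha>(1)] F(1) by simp
qed

lemma elts_subset_small:
  fixes x :: "'k hset"
  assumes "X \<subseteq> elts x"
  shows "elts (set_of X) = X"
proof -
  have "elts x \<lesssim> (UNIV :: 'k index set)" using small_iff[of "elts x"] by (rule iffD1) (rule exI, rule refl)
  then show ?thesis by (rule elts_set_of[OF lepoll_trans[OF subset_imp_lepoll[OF assms]]])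
qed

lemma elts_S20: "elts S20 = {\<alpha>\<in>elts omega2. has_cf \<alpha> omega}"
  unfolding S20_def by (rule elts_subset_small[of _ omega2]) blast

text \<open>There may be more than \<open>\<omega>\<^sub>1\<close> conditions bounded below a given \<open>\<alpha> < \<omega>\<^sub>2\<close> (without CH), so \<open>\<alpha>\<close> is not
  closed under extending arbitrary conditions.  Instead each finite sequence \<open>s\<close> of ordinals steers a
  single descending sequence with last entry \<open>pp s\<close>, and \<open>\<alpha> \<in> S\<close> is a closure point of
  \<open>s \<mapsto> max (pp s)\<close>; following a cofinal \<open>\<omega>\<close>-sequence of \<open>\<alpha>\<close> gives conditions whose union can be
  closed off by \<open>\<alpha>\<close>.\<close>

lemma shoot_distributive:
  assumes S: "elts S \<subseteq> elts S20" "stationary omega2 S"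
    and dense: "\<And>n p. p \<in> shoot_conditions S \<Longrightarrow> \<exists>p'\<in>shoot_conditions S. elts p \<subseteq> elts p' \<and> p' \<in> D n"
    and down: "\<And>n p p'. p \<in> D n \<Longrightarrow> p' \<in> shoot_conditions S \<Longrightarrow> elts p \<subseteq> elts p' \<Longrightarrow> p' \<in> D n"
    and q: "q \<in> shoot_conditions S"
  obtains p where "p \<in> shoot_conditions S" "elts q \<subseteq> elts p" "\<And>n::nat. p \<in> D n"
proof -
  let ?P = "shoot_conditions S"
  have S2: "elts S \<subseteq> elts omega2" using S(2) unfolding stationary_def by blast
  have "\<exists>\<beta> F. p = vfun (vsucc \<beta>) F \<and> shoot_map S \<beta> F" if "p \<in> ?P" for p
    using that unfolding shoot_conditions_eq by blast
  then obtain len fn where lf: "\<And>p. p \<in> ?P \<Longrightarrow> p = vfun (vsucc (len p)) (fn p) \<and> shoot_map S (len p) (fn p)"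
    by metis
  define mx where "mx = (\<lambda>p. fn p (len p))"
  have mx: "mx p \<in> elts omega2" if "p \<in> ?P" for p
    using lf[OF that] S2 unfolding mx_def shoot_map_def by (auto simp: elts_vsucc)
  \<comment> \<open>Climb above \<open>\<gamma>\<close> first and enter \<open>D n\<close>
    afterwards: a further extension cannot lower the last value.\<close>
  have "\<exists>p'\<in>?P. elts p \<subseteq> elts p' \<and> p' \<in> D n \<and> \<gamma> \<in> elts (mx p')"
    if p: "p \<in> ?P" and \<gamma>: "\<gamma> \<in> elts omega2" for n p \<gamma>
  proof -
    obtain \<beta> F where F: "shoot_map S \<beta> F" "elts p \<subset> elts (vfun (vsucc \<beta>) F)" "\<gamma> \<in> elts (F \<beta>)"
      by (rule shoot_unbounded[OF S(2) p \<gamma>])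
    then obtain p' where p': "p' \<in> ?P" "elts (vfun (vsucc \<beta>) F) \<subseteq> elts p'" "p' \<in> D n"
      using dense unfolding shoot_conditions_eq by blast
    note l = lf[OF p'(1)]
    have "\<beta> \<in> elts (vsucc (len p'))" "fn p' \<beta> = F \<beta>"
      using p'(2) l vfun_subset_iff[of "vsucc \<beta>" F "vsucc (len p')" "fn p'"] by (auto simp: elts_vsucc[of \<beta>])
    then have "F \<beta> = mx p' \<or> F \<beta> \<in> elts (mx p')"
      using l unfolding shoot_map_def mx_def by (auto simp: elts_vsucc)
    then have "\<gamma> \<in> elts (mx p')"
      using F(3) mx[OF p'(1)] Ord_trans by (auto simp: elts_omega2)
    then show ?thesis using p' F(2) by blast
  qed
  then have ex: "\<exists>p'. p' \<in> ?P \<and> elts p \<subseteq> elts p' \<and> p' \<in> D n \<and> \<gamma> \<in> elts (mx p')"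
    if "p \<in> ?P" "\<gamma> \<in> elts omega2" for n p \<gamma>
    using that by blast
  define g where
    "g = (\<lambda>n p \<gamma>. SOME p'. p' \<in> ?P \<and> elts p \<subseteq> elts p' \<and> p' \<in> D n \<and> \<gamma> \<in> elts (mx p'))"
  have g: "g n p \<gamma> \<in> ?P \<and> elts p \<subseteq> elts (g n p \<gamma>) \<and> g n p \<gamma> \<in> D n \<and> \<gamma> \<in> elts (mx (g n p \<gamma>))"
    if "p \<in> ?P" "\<gamma> \<in> elts omega2" for n p \<gamma>
    unfolding g_def by (rule someI_ex[OF ex[OF that]])
  \<comment> \<open>The latest ordinal stands at the head, so the tail encodes the previous stage;
    its length selects the next dense set.\<close>
  define pp where "pp = rec_list q (\<lambda>\<gamma> s p. g (length s) p \<gamma>)"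
  have pp: "pp [] = q" "pp (\<gamma> # s) = g (length s) (pp s) \<gamma>" for \<gamma> s unfolding pp_def by simp_all
  have ppP: "pp s \<in> ?P" if "s \<in> lists (elts omega2)" for s
    using that by (induction s) (auto simp: pp q g)
  obtain \<alpha> where \<alpha>: "\<alpha> \<in> elts S" "\<And>s. s \<in> lists (elts \<alpha>) \<Longrightarrow> mx (pp s) \<in> elts \<alpha>"
    by (rule stationary_closure_point[OF S(2), of "\<lambda>s. mx (pp s)", OF mx[OF ppP]]) simp_all
  have Ord: "Ord \<alpha>" using \<alpha>(1) S2 by (auto simp: elts_omega2)
  have \<alpha>2: "elts \<alpha> \<subseteq> elts omega2"
    by (rule omega2_trans[OF subsetD[OF S2 \<alpha>(1)]])
  have "\<alpha> \<in> elts S20" using \<alpha>(1) S(1) by blast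
  then obtain f where f: "cofinal_map f omega \<alpha>" unfolding elts_S20 has_cf_def by blast
  \<comment> \<open>An element of \<open>\<alpha>\<close> shows that \<open>omega\<close>, which
    maps cofinally into it, is nonempty; \<open>from_nat_into\<close> requires this.\<close>
  have "mx (pp []) \<in> elts \<alpha>" by (rule \<alpha>(2)) simp
  then have "elts (omega :: 'a hset) \<noteq> {}" using f unfolding cofinal_map_def by blast
  then have ran: "range (from_nat_into (elts (omega :: 'a hset))) = elts omega"
    by (rule range_from_nat_into[OF _ countable_omega])
  define \<gamma> where "\<gamma> = (\<lambda>n. f (from_nat_into (elts omega) n))"
  have \<gamma>: "\<gamma> n \<in> elts \<alpha>" for n
    using f ran unfolding cofinal_map_def \<gamma>_def by blast
  have cof: "\<exists>n. \<zeta> = \<gamma> n \<or> \<zeta> \<in> elts (\<gamma> n)" if \<zeta>: "\<zeta> \<in> elts \<alpha>" for \<zeta>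
  proof -
    obtain \<xi> where \<xi>: "\<xi> \<in> elts omega" "\<zeta> = f \<xi> \<or> \<zeta> \<in> elts (f \<xi>)"
      using f \<zeta> unfolding cofinal_map_def by blast
    then obtain n where "\<xi> = from_nat_into (elts omega) n" using ran by blast
    then show ?thesis using \<xi>(2) unfolding \<gamma>_def by blast
  qed
  define s where "s = rec_nat [] (\<lambda>n s. \<gamma> n # s)"
  have s: "s 0 = []" "s (Suc n) = \<gamma> n # s n" "length (s n) = n" for n
  proof -
    show *: "s 0 = []" "s (Suc n) = \<gamma> n # s n" for n unfolding s_def by simp_all
    show "length (s n) = n" by (induction n) (simp_all add: *)
  qed
  have s\<alpha>: "s n \<in> lists (elts \<alpha>)" for n by (induction n) (simp_all add: s \<gamma>)
  have s2: "s n \<in> lists (elts omega2)" for n using s\<alpha>[of n] \<alpha>2 by auto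
  \<comment> \<open>As \<open>s n\<close> has length n, stage n + 1 meets \<open>D n\<close>, and
    its last value exceeds \<open>\<gamma> n\<close>.\<close>
  have step: "elts (pp (s n)) \<subseteq> elts (pp (s (Suc n)))" "pp (s (Suc n)) \<in> D n"
      "\<gamma> n \<in> elts (mx (pp (s (Suc n))))" for n
    using g[OF ppP[OF s2], of "\<gamma> n" n n] \<gamma> \<alpha>2 by (auto simp: s pp)
  let ?p = "\<lambda>n. pp (s n)"
  have lfp: "vfun (vsucc (len (?p n))) (fn (?p n)) = ?p n" "shoot_map S (len (?p n)) (fn (?p n))" for n
    using lf[OF ppP[OF s2]] by simp_all
  obtain \<delta> G where G: "shoot_map S \<delta> G"
    "\<And>n. elts (vfun (vsucc (len (?p n))) (fn (?p n))) \<subseteq> elts (vfun (vsucc \<delta>) G)"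
  proof (rule shoot_map_limit[of S "\<lambda>n. len (?p n)" "\<lambda>n. fn (?p n)" \<alpha>])
    show "shoot_map S (len (?p n)) (fn (?p n))" for n by (rule lfp)
    show "elts (vfun (vsucc (len (?p n))) (fn (?p n)))
      \<subseteq> elts (vfun (vsucc (len (?p (Suc n)))) (fn (?p (Suc n))))" for n
      unfolding lfp(1) by (rule step)
    show "fn (?p n) (len (?p n)) \<in> elts \<alpha>" for n
      using \<alpha>(2)[OF s\<alpha>] unfolding mx_def .
    fix \<zeta> assume "\<zeta> \<in> elts \<alpha>"
    then obtain n where "\<zeta> = \<gamma> n \<or> \<zeta> \<in> elts (\<gamma> n)" using cof by blast
    moreover have "Ord (mx (?p (Suc n)))" using mx[OF ppP[OF s2]] by (simp add: elts_omega2)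
    ultimately have "\<zeta> \<in> elts (mx (?p (Suc n)))" using step(3)[of n] Ord_trans by blast
    then show "\<exists>n. \<zeta> \<in> elts (fn (?p n) (len (?p n)))" unfolding mx_def by blast
  qed (use \<alpha> Ord in auto)
  have GP: "vfun (vsucc \<delta>) G \<in> ?P" unfolding shoot_conditions_eq using G(1) by blast
  show ?thesis
  proof (rule that[OF GP])
    show "elts q \<subseteq> elts (vfun (vsucc \<delta>) G)" using G(2)[of 0] unfolding lfp(1) by (simp add: s pp)
    show "vfun (vsucc \<delta>) G \<in> D n" for n
      by (rule down[OF step(2) GP]) (use G(2)[of "Suc n"] in \<open>unfold lfp(1)\<close>)
  qed
qed

section \<open>Distributive posets are hemi-proper\<close>

lemma forces_ExistsD:
  assumes "forces P R p e (Exists \<phi>)" "q \<in> elts P" "le R q p"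
  obtains r \<tau> where "is_name P \<tau>" "r \<in> elts P" "le R r q" "forces P R r (case_nat \<tau> e) \<phi>"
  using assms by auto

lemma forces_ImpD:
  assumes "forces P R p e (Imp \<phi> \<psi>)" "q \<in> elts P" "le R q p" "forces P R q e \<phi>"
  obtains r where "r \<in> elts P" "le R r q" "forces P R r e \<psi>"
  using assms by auto

text \<open>Values are decided only within \<open>H \<theta>\<close>; this makes sure that all
  countable ordinals are among them.\<close>

lemma countable_Ord_in_H:
  assumes "(UNIV :: nat set) \<prec> elts \<theta>" "\<xi> \<in> elts omega1"
  shows "\<xi> \<in> H \<theta>"
proof -
  have \<xi>: "Ord \<xi>" "countable (elts \<xi>)" using assms(2) by (simp_all add: elts_omega1)
  have "trcl \<xi> \<subseteq> elts \<xi>"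
    by (rule trcl_least) (use Ord_trans[OF \<xi>(1)] in \<open>auto simp: tset_def\<close>)
  then have "trcl \<xi> \<lesssim> elts \<xi>" by (rule subset_imp_lepoll)
  also have "elts \<xi> \<lesssim> (UNIV :: nat set)" using \<xi>(2) unfolding countable_def lepoll_def by blast
  also have "(UNIV :: nat set) \<prec> elts \<theta>" by (rule assms(1))
  finally show ?thesis unfolding H_def by simp
qed

context forcing_poset
begin

text \<open>Suppose the set named by \<open>b\<close>, which is N \<inter> \<open>omega1\<close>,
  were a member of M[G] \<inter> \<open>omega1\<close>, named by \<open>a\<close>. Its value
  \<open>\<xi>\<close> would be a countable ordinal with a name in M, so \<open>bound\<close> puts
  \<open>\<xi>\<close> into N and thus into the set named by \<open>b\<close>, that is, into itself.
  This avoids showing that the two sets are ordinals.\<close>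

lemma not_forces_inter_greater:
  assumes p: "p \<in> elts P" "le R p q"
    and bound: "\<And>r \<tau> \<xi>. r \<in> elts P \<Longrightarrow> le R r p \<Longrightarrow> \<tau> \<in> elts M \<Longrightarrow> \<xi> \<in> elts omega1 \<Longrightarrow>
      forces_val P R r \<tau> \<xi> \<Longrightarrow> \<xi> \<in> elts N"
  shows "\<not> forces P R q (case_nat (ext_name P M) (case_nat (check P N) (\<lambda>_. check P omega1)))
            inter_greater"
proof
  let ?m = "ext_name P M" and ?n = "check P N" and ?w = "check P omega1"
  assume "forces P R q (case_nat ?m (case_nat ?n (\<lambda>_. ?w))) inter_greater"
  then obtain a r1 where r1: "is_name P a" "r1 \<in> elts P" "le R r1 p" and
    f1: "forces P R r1 (case_nat a (case_nat ?m (case_nat ?n (\<lambda>_. ?w))))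
      (Exists (And (Forall (Iff (Mem 0 2) (And (Mem 0 5) (Mem 0 3))))
            (And (Forall (Iff (Mem 0 1) (And (Mem 0 5) (Mem 0 4))))
                 (Mem 0 1))))"
    unfolding inter_greater_def using forces_ExistsD p by metis
  from f1 obtain b r2 where r2: "is_name P b" "r2 \<in> elts P" "le R r2 r1" and
    f2: "forces P R r2 (case_nat b (case_nat a (case_nat ?m (case_nat ?n (\<lambda>_. ?w)))))
      (And (Forall (Iff (Mem 0 2) (And (Mem 0 5) (Mem 0 3))))
            (And (Forall (Iff (Mem 0 1) (And (Mem 0 5) (Mem 0 4))))
                 (Mem 0 1)))"
    using forces_ExistsD r1(2) le_refl by metis
  \<comment> \<open>Indices 0 to 5 stand for z, \<open>b\<close>, \<open>a\<close> and the names of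
    M[G], N and \<open>omega1\<close>.\<close>
  let ?e = "\<lambda>z. case_nat z (case_nat b (case_nat a (case_nat ?m (case_nat ?n (\<lambda>_. ?w)))))"
  have imp_a: "forces P R r2 (?e z) (Imp (Mem 0 2) (And (Mem 0 5) (Mem 0 3)))"
    and imp_b: "forces P R r2 (?e z) (Imp (And (Mem 0 5) (Mem 0 4)) (Mem 0 1))" if "is_name P z" for z
    using f2 that by simp_all
  \<comment> \<open>The first instance of z is \<open>b\<close> itself.\<close>
  have "forces P R r2 (?e b) (Mem 0 2)" using f2 by (simp add: numeral_eq_Suc)
  from forces_ImpD[OF imp_a[OF r2(1)] r2(2) le_refl[OF r2(2)] this]
  obtain r3 where r3: "r3 \<in> elts P" "le R r3 r2" "forces_mem P R r3 b ?w" "forces_mem P R r3 b ?m"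
    by (auto simp: numeral_eq_Suc)
  obtain r4 \<sigma> s where r4: "r4 \<in> elts P" "le R r4 r3" "vpair \<sigma> s \<in> elts ?w" "forces_eq P R r4 b \<sigma>"
    using forces_memD[OF r3(3,1) le_refl[OF r3(1)]] by metis
  then obtain \<xi> where \<xi>: "\<xi> \<in> elts omega1" "\<sigma> = check P \<xi>" by (auto simp: elts_check)
  have val_b: "forces_val P R r4 b \<xi>"
    by (rule forces_val_if_forces_eq_check) (use r4(4) \<xi>(2) in simp)
  obtain r5 \<tau> s' where r5: "r5 \<in> elts P" "le R r5 r4" "vpair \<tau> s' \<in> elts ?m" "forces_eq P R r5 b \<tau>"
    using forces_memD[OF r3(4) r4(1,2)] by metis
  have "\<tau> \<in> elts M" using r5(3) by (auto simp: elts_ext_name)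
  moreover have "forces_val P R r5 \<tau> \<xi>"
    by (rule forces_val_cong[OF r5(4) forces_val_mono[OF val_b r5(2)]])
  moreover have "le R r5 r2" using le_trans[OF le_trans[OF r5(2) r4(2)] r3(2)] .
  then have "le R r5 p" using le_trans[OF le_trans[OF _ r2(3)] r1(3)] by blast
  ultimately have "\<xi> \<in> elts N" using bound r5(1) \<xi>(1) by blast
  \<comment> \<open>The second instance of z is the value of \<open>b\<close>, which thereby becomes
    one of its members.\<close>
  then have "forces P R r5 (?e (check P \<xi>)) (And (Mem 0 5) (Mem 0 4))"
    using \<xi>(1) by (simp add: numeral_eq_Suc forces_mem_check)
  from forces_ImpD[OF imp_b[OF is_name_check] r5(1) \<open>le R r5 r2\<close> this]
  obtain r6 where r6: "r6 \<in> elts P" "le R r6 r5" "forces_mem P R r6 (check P \<xi>) b"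
    by (auto simp: numeral_eq_Suc)
  obtain r7 \<rho> t where r7: "r7 \<in> elts P" "le R r7 r6" "vpair \<rho> t \<in> elts b" "le R r7 t"
      "forces_eq P R r7 (check P \<xi>) \<rho>"
    using forces_memD[OF r6(3,1) le_refl[OF r6(1)]] by metis
  have "le R r7 r4" using le_trans[OF r7(2) le_trans[OF r6(2) r5(2)]] .
  from forces_valD1[OF val_b r7(3,1) this r7(4)]
  obtain r8 y where r8: "r8 \<in> elts P" "le R r8 r7" "y \<in> elts \<xi>" "forces_val P R r8 \<rho> y" by metis
  have "forces_val P R r8 \<rho> \<xi>"
    by (rule forces_val_if_forces_eq_check[OF forces_eq_sym[OF forces_eq_mono[OF r7(5) r8(2)]]])
  then have "y = \<xi>" using forces_val_unique[OF r8(1,4)] by blast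
  then show False using r8(3) elts_irrefl by blast
qed

text \<open>The sets \<open>D n\<close> are dense and open. Infinity of \<open>P\<close> makes
  \<open>\<theta>\<close> uncountable, so that enumerations of countable elements of
  \<open>H \<theta>\<close> fit into it.\<close>

lemma hemi_proper_if_distributive:
  assumes inf_P: "infinite (elts P)"
    and distributive: "\<And>D q. q \<in> elts P \<Longrightarrow>
      (\<And>n p. p \<in> elts P \<Longrightarrow> \<exists>p'\<in>elts P. le R p' p \<and> p' \<in> D n) \<Longrightarrow>
      (\<And>n p p'. p \<in> D n \<Longrightarrow> le R p' p \<Longrightarrow> p' \<in> D n) \<Longrightarrow>
      \<exists>p\<in>elts P. le R p q \<and> (\<forall>n::nat. p \<in> D n)"
  shows "hemi_proper P R"
  unfolding hemi_proper_def
proof (intro conjI allI impI poset)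
  fix \<theta> M N q :: "'k hset"
  let ?A = "H \<theta>"
  assume asm: "regular_cardinal \<theta> \<and> Pow (elts P) \<prec> elts \<theta> \<and>
        countable (elts M) \<and> elementary (elts M) (H \<theta>) \<and>
        countable (elts N) \<and> elementary (elts N) (H \<theta>) \<and>
        vpair P R \<in> elts M \<and> M \<in> elts N \<and> q \<in> elts P \<inter> elts M"
  then have inf: "infinite (elts \<theta>)" unfolding regular_cardinal_def by blast
  have "(UNIV :: nat set) \<lesssim> elts P" using inf_P infinite_le_lepoll by blast
  also have "elts P \<prec> Pow (elts P)" by (rule lesspoll_Pow_self)
  also have "Pow (elts P) \<prec> elts \<theta>" using asm by blast
  finally have unc: "(UNIV :: nat set) \<prec> elts \<theta>" .
  have N: "elementary (elts N) ?A" and M: "M \<in> elts N" "countable (elts M)" using asm by blast+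
  have MN: "elts M \<subseteq> elts N" by (rule countable_elem_subset[OF inf unc N M])
  have NA: "elts N \<subseteq> ?A" using N unfolding elementary_def by blast
  have AE: "y \<in> ?A" if "y \<in> elts x" "x \<in> ?A" for x y
    using tset_H that unfolding tset_def by blast
  have pairN: "vpair P R \<in> elts N" using asm MN by blast
  have PRA: "P \<in> ?A" "R \<in> ?A" using vpair_in_tset[OF tset_H] pairN NA by blast+
  have PN: "P \<in> elts N"
  proof -
    have "\<exists>x\<in>elts N. \<exists>y\<in>?A. case_nat x (\<lambda>_. vpair P R) (Suc 0) = vpair (case_nat x (\<lambda>_. vpair P R) 0) y"
      by (rule elementary_witness[OF N _ _ PRA(1), where Q = "\<lambda>e. \<exists>y\<in>?A. e (Suc 0) = vpair (e 0) y"])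
        (use pairN PRA in \<open>auto intro!: definable_ex definable_pair tset_H\<close>)
    then show ?thesis by auto
  qed
  have RN: "R \<in> elts N"
  proof -
    have "\<exists>y\<in>elts N. \<exists>x\<in>?A. case_nat y (\<lambda>_. vpair P R) (Suc 0) = vpair x (case_nat y (\<lambda>_. vpair P R) 0)"
      by (rule elementary_witness[OF N _ _ PRA(2), where Q = "\<lambda>e. \<exists>x\<in>?A. e (Suc 0) = vpair x (e 0)"])
        (use pairN PRA in \<open>auto intro!: definable_ex definable_pair tset_H\<close>)
    then show ?thesis by auto
  qed
  have q: "q \<in> elts P" "q \<in> elts N" using asm MN by blast+
  \<comment> \<open>The second alternative covers elements of M that never receive a value, so
    deciding conditions are dense for each of them. \<open>P\<close> and \<open>R\<close> are
    arguments so that \<open>?dec\<close> also applies to environment entries in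
    \<open>?Q\<close>.\<close>
  let ?dec = "\<lambda>P R p \<tau>. (\<exists>x\<in>?A. forces_val P R p \<tau> x) \<or>
    (\<forall>r\<in>?A. r \<in> elts P \<longrightarrow> vpair r p \<in> elts R \<longrightarrow> (\<forall>x\<in>?A. \<not> forces_val P R r \<tau> x))"
  let ?en = "from_nat_into (elts M)"
  have en: "range ?en = elts M" by (rule range_from_nat_into) (use asm in auto)
  have "\<exists>p\<in>elts P. le R p q \<and> (\<forall>n. p \<in> {p \<in> elts P. ?dec P R p (?en n)})"
  proof (rule distributive[OF q(1)])
    fix n p assume p: "p \<in> elts P"
    show "\<exists>p'\<in>elts P. le R p' p \<and> p' \<in> {p \<in> elts P. ?dec P R p (?en n)}"
    proof (cases "\<exists>r\<in>elts P. le R r p \<and> (\<exists>x\<in>?A. forces_val P R r (?en n) x)")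
      case True
      then show ?thesis by blast
    next
      case False
      then have "p \<in> {p \<in> elts P. ?dec P R p (?en n)}" using p unfolding le_def by blast
      then show ?thesis using p le_refl by blast
    qed
  next
    fix n p p' assume *: "p \<in> {p \<in> elts P. ?dec P R p (?en n)}" "le R p' p"
    then have "p' \<in> elts P" using le_in by blast
    moreover have "?dec P R p' (?en n)"
    proof (cases "\<exists>x\<in>?A. forces_val P R p (?en n) x")
      case True
      then show ?thesis using forces_val_mono[OF _ *(2)] by blast
    next
      case False
      then have "\<forall>r\<in>?A. r \<in> elts P \<longrightarrow> vpair r p \<in> elts R \<longrightarrow> (\<forall>x\<in>?A. \<not> forces_val P R r (?en n) x)"
        using *(1) by blast
      then show ?thesis using le_trans[OF _ *(2)] unfolding le_def by blast
    qed
    ultimately show "p' \<in> {p \<in> elts P. ?dec P R p (?en n)}" by blast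
  qed
  then obtain p0 where p0: "p0 \<in> elts P" "le R p0 q" "\<And>n. ?dec P R p0 (?en n)" by blast
  have dec0: "?dec P R p0 \<tau>" if "\<tau> \<in> elts M" for \<tau>
  proof -
    obtain n where "\<tau> = ?en n" using \<open>\<tau> \<in> elts M\<close> en by blast
    then show ?thesis using p0(3)[of n] by simp
  qed
  \<comment> \<open>Behind the condition at index 0, the indices 1 to 4 hold \<open>P\<close>,
    \<open>R\<close>, \<open>q\<close> and \<open>M\<close>.\<close>
  let ?e = "case_nat P (case_nat R (case_nat q (\<lambda>_. M)))"
  have ran: "range ?e \<subseteq> elts N" using PN RN q(2) M(1) by (auto split: nat.splits)
  let ?Q = "\<lambda>e. e 0 \<in> elts (e 1) \<and> vpair (e 0) (e 3) \<in> elts (e 2) \<and>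
    (\<forall>\<tau>\<in>?A. \<tau> \<in> elts (e 4) \<longrightarrow> ?dec (e 1) (e 2) (e 0) \<tau>)"
  have "definable ?A ?Q"
    by (intro definable_intros definable_pair_mem definable_forces_val inf tset_H)
  moreover have "p0 \<in> ?A" using p0(1) PRA AE by blast
  moreover have "?Q (case_nat p0 ?e)"
    using p0(1,2) dec0 by (simp add: numeral_eq_Suc le_def)
  ultimately have "\<exists>p\<in>elts N. ?Q (case_nat p ?e)"
    using elementary_witness[OF N _ ran] by blast
  then obtain p where p: "p \<in> elts N" "p \<in> elts P" "le R p q"
    "\<And>\<tau>. \<tau> \<in> ?A \<Longrightarrow> \<tau> \<in> elts M \<Longrightarrow> ?dec P R p \<tau>"
    by (auto simp: numeral_eq_Suc le_def)
  show "\<not> forces P R q (case_nat (ext_name P M) (case_nat (check P N) (\<lambda>_. check P omega1)))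
            inter_greater"
  proof (rule not_forces_inter_greater[OF p(2,3)])
    fix r \<tau> \<xi>
    assume r: "r \<in> elts P" "le R r p" and \<tau>: "\<tau> \<in> elts M" and \<xi>: "\<xi> \<in> elts omega1"
      and val: "forces_val P R r \<tau> \<xi>"
    have \<tau>N: "\<tau> \<in> elts N" using \<tau> MN by blast
    have "r \<in> ?A" using r(1) PRA AE by blast
    moreover have "\<xi> \<in> ?A" by (rule countable_Ord_in_H[OF unc \<xi>])
    \<comment> \<open>Since \<open>r\<close> gives \<open>\<tau>\<close> the value
      \<open>\<xi>\<close>, the second alternative of \<open>?dec\<close> fails at
      \<open>p\<close>.\<close>
    ultimately obtain x where x: "x \<in> ?A" "forces_val P R p \<tau> x"
      using p(4)[OF _ \<tau>] \<tau>N NA r val unfolding le_def by blast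
    let ?e' = "case_nat P (case_nat R (case_nat p (\<lambda>_. \<tau>)))"
    have ran': "range ?e' \<subseteq> elts N" using PN RN p(1) \<tau>N by (auto split: nat.splits)
    \<comment> \<open>All parameters are in N, so a value is found there, and values are
      unique.\<close>
    have "\<exists>x\<in>elts N. (\<lambda>e. forces_val (e 1) (e 2) (e 3) (e 4) (e 0)) (case_nat x ?e')"
      by (rule elementary_witness[OF N definable_forces_val[OF inf] ran' x(1)])
        (use x(2) in \<open>simp add: numeral_eq_Suc\<close>)
    then obtain x' where x': "x' \<in> elts N" "forces_val P R p \<tau> x'"
      by (auto simp: numeral_eq_Suc)
    have "x' = \<xi>" by (rule forces_val_unique[OF r(1) forces_val_mono[OF x'(2) r(2)] val])
    then show "\<xi> \<in> elts N" using x'(1) by simp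
  qed
qed

end

section \<open>Application to \<open>P_shoot S\<close>\<close>

theorem theorem22:
  fixes S :: "'k hset"
  assumes "elts S \<subseteq> elts S20"
    and "stationary omega2 S"
  shows "hemi_proper (P_shoot S) (reverse_inclusion (P_shoot S))"
proof -
  let ?P = "P_shoot S" and ?R = "reverse_inclusion (P_shoot S)"
  have S2: "elts S \<subseteq> elts omega2" using assms(2) unfolding stationary_def by blast
  note P = elts_P_shoot[OF S2]
  have le_iff: "le ?R p q \<longleftrightarrow> p \<in> elts ?P \<and> q \<in> elts ?P \<and> elts q \<subseteq> elts p" for p q
    unfolding le_def elts_reverse_inclusion by auto
  have "poset ?P ?R"
    unfolding poset_def partial_order_on_def preorder_on_def
  proof (intro conjI)
    show "\<forall>z\<in>elts ?R. \<exists>p\<in>elts ?P. \<exists>q\<in>elts ?P. z = vpair p q"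
      unfolding elts_reverse_inclusion by blast
    show "antisym {(p, q). le ?R p q}"
      unfolding le_iff by (intro antisymI) (simp add: hset_ext[symmetric])
  qed (auto simp: le_iff refl_on_def trans_def)
  then interpret forcing_poset ?P ?R by unfold_locales
  show ?thesis
  proof (cases "elts ?P = {}")
    case True
    \<comment> \<open>Without conditions there is no \<open>q\<close> to consider.\<close>
    then show ?thesis using poset unfolding hemi_proper_def by blast
  next
    case False
    have grow: "\<exists>p'\<in>elts ?P. elts p \<subset> elts p'" if p: "p \<in> elts ?P" for p
    proof -
      obtain \<beta> F where "shoot_map S \<beta> F" using p unfolding P shoot_conditions_eq by blast
      then have "F \<beta> \<in> elts omega2" using S2 unfolding shoot_map_def by (auto simp: elts_vsucc)
      then obtain \<delta> G where "shoot_map S \<delta> G" "elts p \<subset> elts (vfun (vsucc \<delta>) G)"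
        using shoot_unbounded[OF assms(2) p[unfolded P]] by metis
      then show ?thesis unfolding P shoot_conditions_eq by blast
    qed
    have "infinite (elts ?P)"
    proof
      assume "finite (elts ?P)"
      \<comment> \<open>A finite nonempty family of sets has a member maximal under inclusion, which
        \<open>grow\<close> rules out.\<close>
      then obtain m where "m \<in> elts ` elts ?P" "\<forall>b\<in>elts ` elts ?P. m \<subseteq> b \<longrightarrow> m = b"
        using finite_has_maximal[of "elts ` elts ?P"] False by auto
      then show False using grow by blast
    qed
    then show ?thesis
    proof (rule hemi_proper_if_distributive)
      fix D :: "nat \<Rightarrow> 'k hset set" and q
      assume q: "q \<in> elts ?P"
        and dense: "\<And>n p. p \<in> elts ?P \<Longrightarrow> \<exists>p'\<in>elts ?P. le ?R p' p \<and> p' \<in> D n"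
        and down: "\<And>n p p'. p \<in> D n \<Longrightarrow> le ?R p' p \<Longrightarrow> p' \<in> D n"
      obtain p where "p \<in> elts ?P" "elts q \<subseteq> elts p" "\<And>n. p \<in> D n \<inter> elts ?P"
      \<comment> \<open>Intersecting with \<open>P\<close> lets inclusion be read as the order,
        which relates only conditions.\<close>
      proof (rule shoot_distributive[OF assms, of "\<lambda>n. D n \<inter> elts ?P" q])
        fix n p assume "p \<in> shoot_conditions S"
        then show "\<exists>p'\<in>shoot_conditions S. elts p \<subseteq> elts p' \<and> p' \<in> D n \<inter> elts ?P"
          using dense[of p n] unfolding le_iff P by blast
      next
        fix n p p' assume "p \<in> D n \<inter> elts ?P" "p' \<in> shoot_conditions S" "elts p \<subseteq> elts p'"
        then show "p' \<in> D n \<inter> elts ?P" using down[of p n p'] unfolding le_iff P by blast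
      qed (use q P in auto)
      then show "\<exists>p\<in>elts ?P. le ?R p q \<and> (\<forall>n. p \<in> D n)" using q unfolding le_iff by blast
    qed
  qed
qed

end
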